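(* Let $G$ be a direct sum of cyclic abelian groups, and write $G=F\oplus T$ with $F$ free and $T=\bigoplus_p T_p$ the primary decomposition of the torsion subgroup $T$. Then the following are equivalent: (i) $G$ is relatively Hopfian; (ii) $G$ is Hopfian; (iii) the torsion-free part $F$ and each $p$-component $T_p$ have finite rank.
   Context: All groups are abelian, written additively. A group $G$ is Hopfian if every surjective endomorphism of $G$ is injective. $G$ is relatively Hopfian if, for every group $A$, the existence of a surjective homomorphism $G\to G\oplus A$ implies $A=\{0\}$. The rank of a $p$-group $T_p$ is the dimension of its socle $T_p[p]=\{x\in T_p: px=0\}$ over the field with $p$ elements. *)

theory Defs
  imports "HOL-Algebra.Algebra"
begin

text \<open>Groups are written multiplicatively, following the conventions of HOL-Algebra; the direct
  sum of two groups is \<open>\<times>\<times>\<close> and that of a family is \<^const>\<open>sum_group\<close>.\<close>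

definition hopfian :: "('a, 'b) monoid_scheme \<Rightarrow> bool" where
  "hopfian G \<longleftrightarrow> (\<forall>f \<in> epi G G. inj_on f (carrier G))"

text \<open>A quantifier inside a definition cannot range over types, so \<open>A\<close> is restricted to carriers
  in the type \<open>'a\<close> of \<open>G\<close>. This loses nothing, since \<open>A\<close> is a quotient of \<open>G\<close>: the lemma
  \<open>relatively_hopfian_all_types\<close> below gives the same property for \<open>A\<close> over any type.\<close>

definition relatively_hopfian :: "('a, 'b) monoid_scheme \<Rightarrow> bool" where
  "relatively_hopfian G \<longleftrightarrow>
     (\<forall>A :: 'a monoid. comm_group A \<longrightarrow> epi G (G \<times>\<times> A) \<noteq> {} \<longrightarrow> trivial_group A)"

lemma relatively_hopfian_all_types:
  fixes G :: "('a, 'b) monoid_scheme" and A :: "('c, 'd) monoid_scheme"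
  assumes "comm_group G" and "relatively_hopfian G"
    and "comm_group A" and "epi G (G \<times>\<times> A) \<noteq> {}"
  shows "trivial_group A"
proof -
  interpret G: comm_group G by fact
  interpret A: comm_group A by fact
  obtain f where f: "f \<in> hom G (G \<times>\<times> A)" and surj: "f ` carrier G = carrier (G \<times>\<times> A)"
    using assms(4) by (auto simp: epi_def)
  have onto: "carrier A \<subseteq> (\<lambda>x. snd (f x)) ` carrier G"
  proof
    fix a assume "a \<in> carrier A"
    then have "(\<one>\<^bsub>G\<^esub>, a) \<in> f ` carrier G" by (simp add: surj)
    then obtain x where "x \<in> carrier G" "f x = (\<one>\<^bsub>G\<^esub>, a)" by auto
    then show "a \<in> (\<lambda>x. snd (f x)) ` carrier G" by (intro image_eqI[of _ _ x]) auto
  qed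
  define r where "r = inv_into (carrier G) (\<lambda>x. snd (f x))"
  define s where "s = inv_into (carrier A) r"
  have inj: "inj_on r (carrier A)"
    unfolding r_def using onto by (rule inj_on_inv_into)
  then have sr: "s (r a) = a" if "a \<in> carrier A" for a
    using that by (simp add: s_def)
  define A' :: "'a monoid" where
    "A' = \<lparr>carrier = r ` carrier A, monoid.mult = (\<lambda>x y. r (s x \<otimes>\<^bsub>A\<^esub> s y)), one = r \<one>\<^bsub>A\<^esub>\<rparr>"
  have "comm_group A'"
  proof (rule comm_groupI)
    fix x assume "x \<in> carrier A'"
    then obtain a where a: "a \<in> carrier A" "x = r a" by (auto simp: A'_def)
    then have "r (inv\<^bsub>A\<^esub> a) \<in> carrier A'" "r (inv\<^bsub>A\<^esub> a) \<otimes>\<^bsub>A'\<^esub> x = \<one>\<^bsub>A'\<^esub>"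
      by (auto simp: A'_def sr)
    then show "\<exists>y\<in>carrier A'. y \<otimes>\<^bsub>A'\<^esub> x = \<one>\<^bsub>A'\<^esub>" by blast
  qed (auto simp: A'_def sr A.m_ac)
  moreover have "(\<lambda>x. (fst (f x), r (snd (f x)))) \<in> epi G (G \<times>\<times> A')"
  proof -
    have fc: "fst (f x) \<in> carrier G \<and> snd (f x) \<in> carrier A" if "x \<in> carrier G" for x
      using hom_in_carrier[OF f that] by (auto simp: DirProd_def)
    have "(\<lambda>x. (fst (f x), r (snd (f x)))) \<in> hom G (G \<times>\<times> A')"
    proof (rule homI)
      fix x y assume xy: "x \<in> carrier G" "y \<in> carrier G"
      then show "(fst (f (x \<otimes>\<^bsub>G\<^esub> y)), r (snd (f (x \<otimes>\<^bsub>G\<^esub> y)))) =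
        (fst (f x), r (snd (f x))) \<otimes>\<^bsub>G \<times>\<times> A'\<^esub> (fst (f y), r (snd (f y)))"
        using fc by (simp add: hom_mult[OF f] mult_DirProd' A'_def sr)
    qed (use fc in \<open>auto simp: A'_def\<close>)
    moreover have "(\<lambda>x. (fst (f x), r (snd (f x)))) ` carrier G = map_prod id r ` (f ` carrier G)"
      by (force simp: image_image map_prod_def split_beta)
    ultimately show ?thesis
      using map_prod_surj_on[of id "carrier G" "carrier G" r "carrier A" "r ` carrier A"]
      by (simp add: epi_def surj A'_def)
  qed
  ultimately have "trivial_group A'"
    using assms(2) unfolding relatively_hopfian_def by blast
  then have "r ` carrier A = {r \<one>\<^bsub>A\<^esub>}"
    by (auto simp: trivial_group_def A'_def)
  then have "carrier A = {\<one>\<^bsub>A\<^esub>}"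
    using inj by (auto simp: inj_on_def)
  then show ?thesis
    by (simp add: trivial_group_def A.is_group)
qed

text \<open>A basis of a free group may be taken inside its carrier, hence in the type \<open>'a\<close>.\<close>

definition free_abelian :: "('a, 'b) monoid_scheme \<Rightarrow> bool" where
  "free_abelian G \<longleftrightarrow> (\<exists>B :: 'a set. G \<cong> free_Abelian_group B)"

definition free_finite_rank :: "('a, 'b) monoid_scheme \<Rightarrow> bool" where
  "free_finite_rank G \<longleftrightarrow> (\<exists>B :: 'a set. finite B \<and> G \<cong> free_Abelian_group B)"

definition torsion_part :: "('a, 'b) monoid_scheme \<Rightarrow> 'a set" where
  "torsion_part G = {x \<in> carrier G. \<exists>n::nat. n > 0 \<and> x [^]\<^bsub>G\<^esub> n = \<one>\<^bsub>G\<^esub>}"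

definition primary_part :: "('a, 'b) monoid_scheme \<Rightarrow> nat \<Rightarrow> 'a set" where
  "primary_part G p = {x \<in> carrier G. \<exists>k::nat. x [^]\<^bsub>G\<^esub> (p ^ k) = \<one>\<^bsub>G\<^esub>}"

definition socle :: "('a, 'b) monoid_scheme \<Rightarrow> nat \<Rightarrow> 'a set" where
  "socle G p = {x \<in> carrier G. x [^]\<^bsub>G\<^esub> p = \<one>\<^bsub>G\<^esub>}"

text \<open>Basis of an elementary abelian \<open>p\<close>-group \<open>V\<close> as a vector space over the field with \<open>p\<close>
  elements. The scalars are represented by \<open>0, \<dots>, p - 1\<close>, the scalar \<open>k\<close> acting by \<open>x \<mapsto> x [^] k\<close>.
  A coefficient function \<open>c\<close> vanishes outside \<open>B\<close> and has finite support.\<close>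

definition Fp_basis :: "nat \<Rightarrow> ('a, 'b) monoid_scheme \<Rightarrow> 'a set \<Rightarrow> bool" where
  "Fp_basis p V B \<longleftrightarrow> B \<subseteq> carrier V \<and>
     (\<forall>x \<in> carrier V. \<exists>!c :: 'a \<Rightarrow> nat.
        (\<forall>b. c b < p) \<and> {b. c b \<noteq> 0} \<subseteq> B \<and> finite {b. c b \<noteq> 0} \<and>
        x = (\<Otimes>\<^bsub>V\<^esub>b \<in> {b. c b \<noteq> 0}. b [^]\<^bsub>V\<^esub> c b))"

definition p_group_finite_rank :: "nat \<Rightarrow> ('a, 'b) monoid_scheme \<Rightarrow> bool" where
  "p_group_finite_rank p T \<longleftrightarrow> (\<exists>B. finite B \<and> Fp_basis p (T\<lparr>carrier := socle T p\<rparr>) B)"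

definition internal_direct_sum :: "('a, 'b) monoid_scheme \<Rightarrow> 'a set \<Rightarrow> 'a set \<Rightarrow> bool" where
  "internal_direct_sum G H K \<longleftrightarrow>
     subgroup H G \<and> subgroup K G \<and> H \<inter> K = {\<one>\<^bsub>G\<^esub>} \<and> H <#>\<^bsub>G\<^esub> K = carrier G"

end

theory Submission
  imports Defs
begin

text \<open>All three conditions are equivalent to one condition on a decomposition into cyclic groups of orders
  \<open>n i\<close>, with \<open>n i = 0\<close> for an infinite cyclic group: for each prime \<open>p\<close>, only finitely many \<open>n i\<close> are divisible
  by \<open>p\<close>. As \<open>0\<close> is divisible by every prime, this says that there are finitely many infinite summands and,
  for each \<open>p\<close>, finitely many finite summands of order divisible by \<open>p\<close>.

  If the condition holds, then for each \<open>m > 0\<close> the subgroup of \<open>m\<close>-th powers (the multiples of \<open>m\<close> in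
  additive notation) has finite index. A surjective endomorphism induces a surjective, hence injective, map on
  this finite quotient, so its kernel consists of \<open>m\<close>-th powers for every \<open>m\<close>. In a direct sum of cyclic groups
  only the unit has this property, and \<open>G\<close> is Hopfian (\<open>hopfian_if_finite\<close>).

  A Hopfian group is relatively Hopfian for formal reasons (\<open>relatively_hopfian_if_hopfian\<close>).

  If the condition fails for \<open>p\<close>, there is a sequence of summands, all infinite or all finite of order
  divisible by \<open>p\<close>, in which each term, or its \<open>p\<close>-primary component, is a quotient of the next. Shifting along
  this sequence maps \<open>G\<close> onto the direct sum of \<open>G\<close> and the component of the first term
  (\<open>finite_dvd_if_relatively_hopfian\<close>).

  The condition agrees with finiteness of the ranks: the infinite summands give a basis of the torsion-free
  quotient, which is isomorphic to \<open>F\<close> (\<open>finite_infinite_cyclic_iff\<close>), and the elements of order \<open>p\<close> in the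
  finite summands of order divisible by \<open>p\<close> give a basis of the socle (\<open>finite_p_divisible_iff_Fp_basis\<close>).\<close>

section \<open>Presentations of direct sums of cyclic groups\<close>

abbreviation keys where "keys \<equiv> Poly_Mapping.keys"
abbreviation lookup where "lookup \<equiv> Poly_Mapping.lookup"

lemma ex_poly_mapping:
  fixes f :: "'i \<Rightarrow> 'b::zero"
  assumes "finite S"
  obtains c where "keys c \<subseteq> S" "\<And>i. lookup c i = (if i \<in> S then f i else 0)"
proof
  have fin: "finite {i. (if i \<in> S then f i else 0) \<noteq> 0}"
    by (rule finite_subset[OF _ assms]) auto
  let ?c = "Poly_Mapping.Abs_poly_mapping (\<lambda>i. if i \<in> S then f i else 0)"
  show l: "lookup ?c i = (if i \<in> S then f i else 0)" for i
    using fin by simp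
  show "keys ?c \<subseteq> S"
    by (auto simp: in_keys_iff l split: if_splits)
qed

text \<open>A direct sum of cyclic groups is handled through a presentation: \<open>G\<close> is the quotient, by way of \<open>e\<close>,
  of the free abelian group on \<open>I\<close> by the subgroup of all \<open>c\<close> whose coordinate at each \<open>i\<close> is a
  multiple of \<open>n i\<close>. Thus \<open>e (frag_of i)\<close> generates the \<open>i\<close>-th summand, and \<open>n i\<close> is its order,
  with \<open>0\<close> standing for an infinite order. This convention lets \<open>p dvd n i\<close> say that the \<open>i\<close>-th summand
  is not divisible by \<open>p\<close>, for finite and infinite summands alike.\<close>

locale cyclic_presentation = comm_group G for G (structure) +
  fixes I :: "'i set" and n :: "'i \<Rightarrow> nat" and e :: "('i \<Rightarrow>\<^sub>0 int) \<Rightarrow> 'a"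
  assumes e_hom: "e \<in> hom (free_Abelian_group I) G"
    and e_onto: "x \<in> carrier G \<Longrightarrow> \<exists>c. keys c \<subseteq> I \<and> x = e c"
    and e_eq_one_iff: "keys c \<subseteq> I \<Longrightarrow> e c = \<one> \<longleftrightarrow> (\<forall>i\<in>I. int (n i) dvd lookup c i)"
begin

sublocale e: group_hom "free_Abelian_group I" G e
  by (simp add: group_hom_def group_hom_axioms_def e_hom is_group)

lemma e_closed: "keys c \<subseteq> I \<Longrightarrow> e c \<in> carrier G"
  using e.hom_closed by simp

lemma e_add: "keys c \<subseteq> I \<Longrightarrow> keys d \<subseteq> I \<Longrightarrow> e (c + d) = e c \<otimes> e d"
  using e.hom_mult by simp

lemma e_diff: "keys c \<subseteq> I \<Longrightarrow> keys d \<subseteq> I \<Longrightarrow> e (c - d) = e c \<otimes> inv e d"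
  using e_add[of c "- d"] e.hom_inv[of d] by simp

lemma e_cmul: "keys c \<subseteq> I \<Longrightarrow> e (frag_cmul m c) = e c [^] (m::int)"
  using e.hom_int_pow[of c m] by simp

lemma e_cmul_nat: "keys c \<subseteq> I \<Longrightarrow> e (frag_cmul (int m) c) = e c [^] m"
  by (simp add: e_cmul int_pow_int)

lemma e_eq_iff:
  assumes "keys c \<subseteq> I" "keys d \<subseteq> I"
  shows "e c = e d \<longleftrightarrow> (\<forall>i\<in>I. int (n i) dvd lookup c i - lookup d i)"
proof -
  have diff: "keys (c - d) \<subseteq> I"
    using assms keys_diff[of c d] by blast
  have "e c = e d \<longleftrightarrow> e (c - d) = \<one>"
    using assms inv_solve_right[of \<one> "e c" "e d"] by (auto simp: e_diff e_closed)
  also have "e (c - d) = \<one> \<longleftrightarrow> (\<forall>i\<in>I. int (n i) dvd lookup c i - lookup d i)"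
    by (simp add: e_eq_one_iff[OF diff] lookup_minus)
  finally show ?thesis .
qed

text \<open>The universal property of a direct sum of cyclic groups: generators may be sent to any elements
  whose orders divide theirs. A homomorphism with the prescribed values exists on the free group, and it
  descends to \<open>G\<close> because it kills the kernel of \<open>e\<close>.\<close>

lemma hom_extension:
  fixes H :: "('h, 'm) monoid_scheme"
  assumes H: "comm_group H"
    and u: "\<And>i. i \<in> I \<Longrightarrow> u i \<in> carrier H" "\<And>i. i \<in> I \<Longrightarrow> u i [^]\<^bsub>H\<^esub> n i = \<one>\<^bsub>H\<^esub>"
  obtains f where "f \<in> hom G H" "\<And>i. i \<in> I \<Longrightarrow> f (e (frag_of i)) = u i"
proof -
  interpret H: comm_group H by fact
  obtain h where h: "h \<in> hom (free_Abelian_group I) H"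
    and hu: "\<And>i. i \<in> I \<Longrightarrow> h (frag_of i) = u i"
    using H.free_Abelian_group_universal[of u I] u(1) by auto
  interpret h: group_hom "free_Abelian_group I" H h
    by (simp add: group_hom_def group_hom_axioms_def h)
  have h_one: "h c = \<one>\<^bsub>H\<^esub>" if c: "keys c \<subseteq> I" "\<forall>i\<in>I. int (n i) dvd lookup c i" for c
  proof -
    have single: "h (frag_cmul (lookup c i) (frag_of i)) = \<one>\<^bsub>H\<^esub>" if i: "i \<in> I" for i
    proof -
      obtain k where "lookup c i = int (n i) * k"
        using bspec[OF c(2) i] unfolding dvd_def by blast
      then have "h (frag_cmul (lookup c i) (frag_of i)) = (u i [^]\<^bsub>H\<^esub> int (n i)) [^]\<^bsub>H\<^esub> k"
        using h.hom_int_pow[of "frag_of i" "lookup c i"] that hu u(1) by (simp add: H.int_pow_pow)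
      then show ?thesis
        using u(2) that by (simp add: int_pow_int)
    qed
    have "keys (\<Sum>i\<in>S. frag_cmul (lookup c i) (frag_of i)) \<subseteq> I \<and>
        h (\<Sum>i\<in>S. frag_cmul (lookup c i) (frag_of i)) = \<one>\<^bsub>H\<^esub>" if "finite S" "S \<subseteq> I" for S
      using that
    proof (induction S rule: finite_induct)
      case empty
      then show ?case
        using h.hom_one by simp
    next
      case (insert i S)
      let ?a = "frag_cmul (lookup c i) (frag_of i)"
      let ?b = "\<Sum>i\<in>S. frag_cmul (lookup c i) (frag_of i)"
      have a: "keys ?a \<subseteq> I"
        using insert.prems keys_cmul[of "lookup c i" "frag_of i"] by auto
      then have "h (?a + ?b) = \<one>\<^bsub>H\<^esub>"
        using insert h.hom_mult[of ?a ?b] single by simp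
      moreover have "keys (?a + ?b) \<subseteq> I"
        using a insert keys_add[of ?a ?b] by auto
      ultimately show ?case
        using insert by simp
    qed
    from this[of "keys c"] have "h (\<Sum>i\<in>keys c. frag_cmul (lookup c i) (frag_of i)) = \<one>\<^bsub>H\<^esub>"
      using c by simp
    then show ?thesis
      using frag_expansion[of c] by (simp add: frag_extend_def)
  qed
  \<comment> \<open>lift \<open>x\<close> along \<open>e\<close>; by \<open>h_one\<close> the value does not depend on the lift\<close>
  define f where "f x = h (SOME c. keys c \<subseteq> I \<and> x = e c)" for x
  have fe: "f (e c) = h c" if c: "keys c \<subseteq> I" for c
  proof -
    define d where "d = (SOME d. keys d \<subseteq> I \<and> e c = e d)"
    have "keys d \<subseteq> I \<and> e c = e d"
      unfolding d_def by (rule someI[of _ c]) (use c in simp)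
    then have d: "keys d \<subseteq> I" "e c = e d"
      by simp_all
    have diff: "keys (d - c) \<subseteq> I"
      using c d(1) keys_diff[of d c] by blast
    have "h (d - c) = \<one>\<^bsub>H\<^esub>"
      using e_eq_iff[OF d(1) c] d(2) by (intro h_one diff) (simp add: lookup_minus)
    then have "h d = h c"
      using h.hom_mult[of "d - c" c] diff c h.hom_closed[of c] by simp
    then show ?thesis
      by (simp add: f_def d_def)
  qed
  show thesis
  proof
    show "f \<in> hom G H"
    proof (rule homI)
      fix x assume "x \<in> carrier G"
      then show "f x \<in> carrier H"
        using e_onto[of x] fe h.hom_closed by force
    next
      fix x y assume "x \<in> carrier G" "y \<in> carrier G"
      then obtain c d where cd: "keys c \<subseteq> I" "x = e c" "keys d \<subseteq> I" "y = e d"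
        using e_onto[of x] e_onto[of y] by blast
      moreover have "keys (c + d) \<subseteq> I"
        using cd(1,3) keys_add[of c d] by blast
      ultimately show "f (x \<otimes> y) = f x \<otimes>\<^bsub>H\<^esub> f y"
        using h.hom_mult[of c d] by (simp add: fe flip: e_add)
    qed
    show "f (e (frag_of i)) = u i" if "i \<in> I" for i
      using that hu by (simp add: fe)
  qed
qed

end

text \<open>Choosing a generator of each summand presents the direct sum; \<open>ord\<close> takes the value \<open>0\<close> on
  elements of infinite order, as the presentation requires.\<close>

lemma ex_cyclic_presentation:
  fixes I :: "'i set" and C :: "'i \<Rightarrow> ('c, 'd) monoid_scheme"
  assumes G: "comm_group G"
    and C: "\<And>i. i \<in> I \<Longrightarrow> group (C i) \<and> cyclic_group (C i)"
    and iso: "G \<cong> sum_group I C"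
  obtains n e where "cyclic_presentation G I n e"
proof -
  interpret G: comm_group G by fact
  have Cg: "\<And>i. i \<in> I \<Longrightarrow> group (C i)"
    using C by blast
  interpret S: group "sum_group I C"
    using Cg by simp
  obtain \<phi> where \<phi>: "\<phi> \<in> iso (sum_group I C) G"
    using G.iso_sym[OF iso] by (auto simp: is_iso_def)
  interpret \<phi>: group_hom "sum_group I C" G \<phi>
    using \<phi> by (simp add: group_hom_def group_hom_axioms_def iso_def)
  have \<phi>_bij: "bij_betw \<phi> (carrier (sum_group I C)) (carrier G)"
    using \<phi> by (simp add: iso_def)
  have "\<forall>i\<in>I. \<exists>x. x \<in> carrier (C i) \<and> carrier (C i) = range (\<lambda>k::int. x [^]\<^bsub>C i\<^esub> k)"
  proof
    fix i assume "i \<in> I"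
    then show "\<exists>x. x \<in> carrier (C i) \<and> carrier (C i) = range (\<lambda>k::int. x [^]\<^bsub>C i\<^esub> k)"
      using group.cyclic_group[of "C i"] C[of i] by blast
  qed
  from bchoice[OF this] obtain g where
    "\<forall>i\<in>I. g i \<in> carrier (C i) \<and> carrier (C i) = range (\<lambda>k::int. g i [^]\<^bsub>C i\<^esub> k)" ..
  then have g: "\<And>i. i \<in> I \<Longrightarrow> g i \<in> carrier (C i)"
    and gen: "\<And>i. i \<in> I \<Longrightarrow> carrier (C i) = range (\<lambda>k::int. g i [^]\<^bsub>C i\<^esub> k)"
    by blast+
  define n where "n i = group.ord (C i) (g i)" for i
  have pow_one_iff: "g i [^]\<^bsub>C i\<^esub> k = \<one>\<^bsub>C i\<^esub> \<longleftrightarrow> int (n i) dvd k" if "i \<in> I" for i and k :: int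
    using group.int_pow_eq_id[OF Cg g, OF that that] by (simp add: n_def)
  define v where "v c = (\<lambda>i\<in>I. g i [^]\<^bsub>C i\<^esub> lookup c i)" for c :: "'i \<Rightarrow>\<^sub>0 int"
  have v_closed: "v c \<in> carrier (sum_group I C)" for c
  proof -
    have "{i \<in> I. v c i \<noteq> \<one>\<^bsub>C i\<^esub>} \<subseteq> keys c"
      by (auto simp: v_def in_keys_iff)
    then have "finite {i \<in> I. v c i \<noteq> \<one>\<^bsub>C i\<^esub>}"
      by (rule finite_subset) simp
    then show ?thesis
      using Cg g by (auto simp: carrier_sum_group v_def group.int_pow_closed)
  qed
  have "cyclic_presentation G I n (\<phi> \<circ> v)"
  proof (intro cyclic_presentation.intro cyclic_presentation_axioms.intro G)
    have "v \<in> hom (free_Abelian_group I) (sum_group I C)"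
    proof (rule homI)
      fix c d :: "'i \<Rightarrow>\<^sub>0 int"
      show "v (c \<otimes>\<^bsub>free_Abelian_group I\<^esub> d) = v c \<otimes>\<^bsub>sum_group I C\<^esub> v d"
        by (auto simp: v_def lookup_add fun_eq_iff group.int_pow_mult[OF Cg g])
    qed (rule v_closed)
    then show "\<phi> \<circ> v \<in> hom (free_Abelian_group I) G"
      using \<phi>.homh by (rule hom_compose)
  next
    fix x assume "x \<in> carrier G"
    then obtain y where y: "y \<in> carrier (sum_group I C)" "x = \<phi> y"
      using \<phi>_bij by (auto simp: bij_betw_def)
    then have yC: "\<And>i. i \<in> I \<Longrightarrow> y i \<in> carrier (C i)" and fin: "finite {i \<in> I. y i \<noteq> \<one>\<^bsub>C i\<^esub>}"
      and ext: "y \<in> extensional I"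
      using Cg by (auto simp: carrier_sum_group PiE_iff)
    have "\<forall>i\<in>I. \<exists>k::int. y i = g i [^]\<^bsub>C i\<^esub> k"
      using yC gen by blast
    from bchoice[OF this] obtain k :: "'i \<Rightarrow> int" where k: "\<And>i. i \<in> I \<Longrightarrow> y i = g i [^]\<^bsub>C i\<^esub> k i"
      by blast
    obtain c where c: "keys c \<subseteq> {i \<in> I. y i \<noteq> \<one>\<^bsub>C i\<^esub>}"
      "\<And>i. lookup c i = (if i \<in> {i \<in> I. y i \<noteq> \<one>\<^bsub>C i\<^esub>} then k i else 0)"
      using ex_poly_mapping[OF fin] by blast
    have "v c = y"
      using c(2) k ext by (auto simp: v_def extensional_def fun_eq_iff)
    then show "\<exists>c. keys c \<subseteq> I \<and> x = (\<phi> \<circ> v) c"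
      using c(1) y(2) by (intro exI[of _ c]) auto
  next
    fix c :: "'i \<Rightarrow>\<^sub>0 int"
    have "(\<phi> \<circ> v) c = \<one>\<^bsub>G\<^esub> \<longleftrightarrow> v c = \<one>\<^bsub>sum_group I C\<^esub>"
      using \<phi>_bij v_closed[of c] by (metis S.one_closed \<phi>.hom_one bij_betw_def comp_apply inj_on_eq_iff)
    also have "\<dots> \<longleftrightarrow> (\<forall>i\<in>I. int (n i) dvd lookup c i)"
      using pow_one_iff by (auto simp: v_def fun_eq_iff)
    finally show "(\<phi> \<circ> v) c = \<one>\<^bsub>G\<^esub> \<longleftrightarrow> (\<forall>i\<in>I. int (n i) dvd lookup c i)" .
  qed
  then show thesis ..
qed

section \<open>Finitely many summands at each prime imply the Hopf property\<close>

text \<open>The mechanism behind the Hopf property of residually finite groups: a surjective endomorphism that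
  preserves \<open>N\<close> induces a surjective self-map of the finite set of cosets of \<open>N\<close>. That map is therefore
  injective, so only \<open>N\<close> itself is mapped to \<open>N\<close>.\<close>

lemma (in group) mem_subgroup_if_surj_image_mem:
  assumes f: "f \<in> epi G G" and N: "subgroup N G" "f ` N \<subseteq> N" "finite (rcosets N)"
    and x: "x \<in> carrier G" "f x \<in> N"
  shows "x \<in> N"
proof -
  interpret N: subgroup N G by fact
  have fhom: "f \<in> hom G G" and fsurj: "f ` carrier G = carrier G"
    using f by (auto simp: epi_def)
  interpret f: group_hom G G f
    using fhom by (simp add: group_hom_def group_hom_axioms_def)
  have coset_eq_iff: "N #> a = N #> b \<longleftrightarrow> a \<otimes> inv b \<in> N"
    if "a \<in> carrier G" "b \<in> carrier G" for a b
    using that N(1) N.rcos_module[OF is_group, of b a] rcos_self[of a N] repr_independence[of a N b]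
    by auto
  define F where "F Y = N #> f (SOME y. y \<in> carrier G \<and> N #> y = Y)" for Y
  have F: "F (N #> a) = N #> f a" if a: "a \<in> carrier G" for a
  proof -
    define y where "y = (SOME y. y \<in> carrier G \<and> N #> y = N #> a)"
    have y: "y \<in> carrier G \<and> N #> y = N #> a"
      unfolding y_def by (rule someI[of _ a]) (use a in simp)
    then have "y \<otimes> inv a \<in> N"
      using coset_eq_iff a by blast
    then have "f (y \<otimes> inv a) \<in> N"
      using N(2) by blast
    then have "f y \<otimes> inv f a \<in> N"
      using y a by simp
    then have "N #> f y = N #> f a"
      using coset_eq_iff[of "f y" "f a"] y a by simp
    then show ?thesis
      by (simp add: F_def y_def)
  qed
  have "rcosets N \<subseteq> F ` (rcosets N)"
  proof
    fix Y assume "Y \<in> rcosets N"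
    then obtain a where a: "a \<in> carrier G" "Y = N #> a"
      by (auto simp: RCOSETS_def)
    then obtain b where b: "b \<in> carrier G" "a = f b"
      using fsurj by blast
    then have "Y = F (N #> b)"
      using a F by simp
    moreover have "N #> b \<in> rcosets N"
      using b(1) N.subset by (rule rcosetsI[rotated])
    ultimately show "Y \<in> F ` (rcosets N)"
      by blast
  qed
  then have inj: "inj_on F (rcosets N)"
    using N(3) by (rule finite_surj_inj[rotated])
  have "F (N #> x) = F (N #> \<one>)"
    using x coset_eq_iff[of "f x" \<one>] F by simp
  then have "N #> x = N #> \<one>"
    using inj x(1) rcosetsI[OF N.subset x(1)] rcosetsI[OF N.subset one_closed]
    unfolding inj_on_def by blast
  then show ?thesis
    using coset_eq_iff[of x \<one>] x(1) by simp
qed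

lemma (in comm_group) subgroup_powers: "subgroup ((\<lambda>y. y [^] (m::nat)) ` carrier G) G"
proof (rule subgroupI)
  fix a assume "a \<in> (\<lambda>y. y [^] m) ` carrier G"
  then obtain y where "y \<in> carrier G" "a = y [^] m"
    by blast
  then show "inv a \<in> (\<lambda>y. y [^] m) ` carrier G"
    by (intro image_eqI[of _ _ "inv y"]) (simp_all add: nat_pow_inv)
next
  fix a b assume "a \<in> (\<lambda>y. y [^] m) ` carrier G" "b \<in> (\<lambda>y. y [^] m) ` carrier G"
  then obtain y z where "y \<in> carrier G" "a = y [^] m" "z \<in> carrier G" "b = z [^] m"
    by blast
  then show "a \<otimes> b \<in> (\<lambda>y. y [^] m) ` carrier G"
    by (intro image_eqI[of _ _ "y \<otimes> z"]) (simp_all add: nat_pow_distrib)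
next
  show "(\<lambda>y. y [^] m) ` carrier G \<subseteq> carrier G"
    by (rule image_subsetI) simp
  show "(\<lambda>y. y [^] m) ` carrier G \<noteq> {}"
    using one_closed by blast
qed

text \<open>Failing to be coprime to \<open>m\<close> means being divisible by one of the finitely many primes in \<open>m\<close>.\<close>

lemma finite_not_coprime:
  fixes n :: "'i \<Rightarrow> nat"
  assumes fin: "\<And>p. Factorial_Ring.prime p \<Longrightarrow> finite {i \<in> I. p dvd n i}" and m: "m > 0"
  shows "finite {i \<in> I. \<not> coprime (n i) m}"
proof (rule finite_subset)
  show "{i \<in> I. \<not> coprime (n i) m} \<subseteq> (\<Union>p\<in>prime_factors m. {i \<in> I. p dvd n i})"
  proof
    fix i assume i: "i \<in> {i \<in> I. \<not> coprime (n i) m}"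
    then have "gcd (n i) m \<noteq> 1"
      by (simp add: coprime_iff_gcd_eq_1)
    then obtain p where "Factorial_Ring.prime p" "p dvd gcd (n i) m"
      using prime_factor_nat by blast
    then show "i \<in> (\<Union>p\<in>prime_factors m. {i \<in> I. p dvd n i})"
      using i m by (auto simp: prime_factors_dvd)
  qed
  show "finite (\<Union>p\<in>prime_factors m. {i \<in> I. p dvd n i})"
    using fin by (intro finite_UN_I) (auto simp: prime_factors_dvd)
qed

lemma finite_bounded_poly_mappings:
  assumes "finite D" "finite V"
  shows "finite {c :: 'i \<Rightarrow>\<^sub>0 int. keys c \<subseteq> D \<and> (\<forall>i\<in>D. lookup c i \<in> V)}"
proof (rule finite_imageD)
  show "finite (lookup ` {c. keys c \<subseteq> D \<and> (\<forall>i\<in>D. lookup c i \<in> V)})"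
  proof (rule finite_subset[OF _ finite_set_of_finite_funs[OF assms, of 0]], rule image_subsetI)
    fix c :: "'i \<Rightarrow>\<^sub>0 int" assume "c \<in> {c. keys c \<subseteq> D \<and> (\<forall>i\<in>D. lookup c i \<in> V)}"
    then show "lookup c \<in> {f. \<forall>x. (x \<in> D \<longrightarrow> f x \<in> V) \<and> (x \<notin> D \<longrightarrow> f x = 0)}"
      by (auto simp: subset_iff in_keys_iff)
  qed
  show "inj_on lookup {c :: 'i \<Rightarrow>\<^sub>0 int. keys c \<subseteq> D \<and> (\<forall>i\<in>D. lookup c i \<in> V)}"
    by (rule inj_onI) (simp add: lookup_inject)
qed

context cyclic_presentation
begin

text \<open>The subgroups of \<open>m\<close>-th powers intersect trivially: in a finite summand of order \<open>n i\<close> the \<open>n i\<close>-th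
  powers vanish, and in an infinite one no nonzero integer is divisible by all positive integers.\<close>

lemma mem_powers_all_imp_one:
  assumes x: "x \<in> carrier G" and pow: "\<And>m::nat. m > 0 \<Longrightarrow> x \<in> (\<lambda>y. y [^] m) ` carrier G"
  shows "x = \<one>"
proof -
  obtain c where c: "keys c \<subseteq> I" "x = e c"
    using e_onto[OF x] by blast
  have root: "\<exists>k. int (n i) dvd lookup c i - int m * k" if m: "m > 0" and i: "i \<in> I" for m i
  proof -
    obtain y where y: "y \<in> carrier G" "x = y [^] m"
      using pow[OF m] by blast
    obtain d where d: "keys d \<subseteq> I" "y = e d"
      using e_onto[OF y(1)] by blast
    have "keys (frag_cmul (int m) d) \<subseteq> I"
      using d(1) keys_cmul[of "int m" d] by blast
    then have "int (n i) dvd lookup c i - lookup (frag_cmul (int m) d) i"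
      using e_eq_iff[of c "frag_cmul (int m) d"] c d y i by (simp add: e_cmul_nat)
    then show ?thesis
      by (intro exI[of _ "lookup d i"]) simp
  qed
  have "int (n i) dvd lookup c i" if i: "i \<in> I" for i
  proof (cases "n i = 0")
    case True
    \<comment> \<open>an integer divisible by a larger positive integer vanishes\<close>
    obtain k where "lookup c i = int (nat \<bar>lookup c i\<bar> + 1) * k"
      using root[of "nat \<bar>lookup c i\<bar> + 1" i] i True by auto
    then have dvd: "\<bar>lookup c i\<bar> + 1 dvd lookup c i"
      unfolding dvd_def by (intro exI[of _ k]) (simp add: add.commute)
    have "lookup c i = 0"
    proof (rule ccontr)
      assume "lookup c i \<noteq> 0"
      then have "\<bar>\<bar>lookup c i\<bar> + 1\<bar> \<le> \<bar>lookup c i\<bar>"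
        using dvd by (rule dvd_imp_le_int)
      then show False
        by linarith
    qed
    then show ?thesis
      by simp
  next
    case False
    then obtain k where "int (n i) dvd lookup c i - int (n i) * k"
      using root[of "n i" i] i by auto
    then have "int (n i) dvd (lookup c i - int (n i) * k) + int (n i) * k"
      by (intro dvd_add) auto
    then show ?thesis
      by simp
  qed
  then show ?thesis
    using c(2) e_eq_one_iff[OF c(1)] by simp
qed

text \<open>A cyclic summand whose order is coprime to \<open>m\<close> consists of \<open>m\<close>-th powers, and every other summand
  has at most \<open>m\<close> elements modulo \<open>m\<close>-th powers. Only finitely many summands are of the second kind, so
  representatives can be taken with coordinates in \<open>{0..<m}\<close> there and \<open>0\<close> elsewhere.\<close>

lemma finite_rcosets_powers:
  assumes fin: "\<And>p. Factorial_Ring.prime p \<Longrightarrow> finite {i \<in> I. p dvd n i}" and m: "m > (0::nat)"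
  shows "finite (rcosets ((\<lambda>y. y [^] m) ` carrier G))"
proof -
  let ?N = "(\<lambda>y. y [^] m) ` carrier G"
  let ?D = "{i \<in> I. \<not> coprime (n i) m}"
  let ?P = "{c. keys c \<subseteq> ?D \<and> (\<forall>i\<in>?D. lookup c i \<in> {0..<int m})}"
  have "rcosets ?N \<subseteq> (\<lambda>c. ?N #> e c) ` ?P"
  proof
    fix Y assume "Y \<in> rcosets ?N"
    then obtain x where x: "x \<in> carrier G" "Y = ?N #> x"
      by (auto simp: RCOSETS_def)
    obtain d where d: "keys d \<subseteq> I" "x = e d"
      using e_onto[OF x(1)] by blast
    have fin_D: "finite ?D"
      using fin m by (rule finite_not_coprime)
    obtain c where c: "keys c \<subseteq> ?D" "\<And>i. lookup c i = (if i \<in> ?D then lookup d i mod int m else 0)"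
      by (rule ex_poly_mapping[OF fin_D, where f = "\<lambda>i. lookup d i mod int m"]) auto
    \<comment> \<open>\<open>q i\<close> are the coordinates of an \<open>m\<close>-th root of the quotient of \<open>x\<close> by its representative\<close>
    have "\<forall>i. \<exists>q. i \<in> I \<longrightarrow> int (n i) dvd lookup d i - lookup c i - int m * q"
    proof
      fix i
      show "\<exists>q. i \<in> I \<longrightarrow> int (n i) dvd lookup d i - lookup c i - int m * q"
      proof (cases "i \<in> I \<and> coprime (n i) m")
        case True
        then have "gcd (int (n i)) (int m) = 1"
          by (simp add: coprime_iff_gcd_eq_1)
        then obtain u v where "u * int (n i) + v * int m = 1"
          using bezout_int by metis
        then have "lookup d i = lookup d i * (u * int (n i) + v * int m)"
          by simp
        then have "lookup d i - lookup c i - int m * (lookup d i * v) = int (n i) * (lookup d i * u)"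
          using True c(2) by (simp add: algebra_simps)
        then show ?thesis
          by (metis dvd_triv_left)
      next
        case False
        then have "i \<in> I \<longrightarrow> lookup d i - lookup c i - int m * (lookup d i div int m) = 0"
          using c(2) by (auto simp: minus_mod_eq_mult_div)
        then show ?thesis
          by (metis dvd_0_right)
      qed
    qed
    from choice[OF this] obtain q where
      q: "\<And>i. i \<in> I \<Longrightarrow> int (n i) dvd lookup d i - lookup c i - int m * q i"
      by blast
    have "finite (keys d \<union> ?D)"
      using fin_D by simp
    then obtain r where r: "keys r \<subseteq> keys d \<union> ?D"
      "\<And>i. lookup r i = (if i \<in> keys d \<union> ?D then q i else 0)"
      by (rule ex_poly_mapping[where f = q]) auto
    have rI: "keys r \<subseteq> I" and cI: "keys c \<subseteq> I"
      using r(1) c(1) d(1) by auto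
    have mr: "keys (frag_cmul (int m) r) \<subseteq> I"
      using rI keys_cmul[of "int m" r] by blast
    have cr: "keys (frag_cmul (int m) r + c) \<subseteq> I"
      using cI mr keys_add[of "frag_cmul (int m) r" c] by blast
    have "int (n i) dvd lookup d i - lookup (frag_cmul (int m) r + c) i" if "i \<in> I" for i
    proof (cases "i \<in> keys d \<union> ?D")
      case True
      then show ?thesis
        using q[OF that] r(2) by (simp add: lookup_add algebra_simps)
    next
      case False
      then show ?thesis
        using r(2) c(2) by (auto simp: lookup_add in_keys_iff)
    qed
    then have "x = e (frag_cmul (int m) r + c)"
      using e_eq_iff[OF d(1) cr] d(2) by simp
    then have "x = e r [^] m \<otimes> e c"
      using mr cI rI by (simp add: e_add e_cmul_nat)
    then have "x \<in> ?N #> e c"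
      using rI e_closed by (auto simp: r_coset_def)
    then have "Y = ?N #> e c"
      using x repr_independence[OF _ e_closed[OF cI] subgroup_powers] by blast
    moreover have "c \<in> ?P"
    proof -
      have "lookup c i \<in> {0..<int m}" if "i \<in> ?D" for i
        using c(2)[of i] that m by simp
      then show ?thesis
        using c(1) by blast
    qed
    ultimately show "Y \<in> (\<lambda>c. ?N #> e c) ` ?P"
      by blast
  qed
  moreover have "finite ?P"
    using fin m by (intro finite_bounded_poly_mappings finite_not_coprime) auto
  ultimately show ?thesis
    by (rule finite_subset[OF _ finite_imageI])
qed

text \<open>An element of the kernel of a surjective endomorphism lies in every subgroup of \<open>m\<close>-th powers, because
  these are preserved and of finite index; hence it is trivial.\<close>

lemma hopfian_if_finite:
  assumes fin: "\<And>p. Factorial_Ring.prime p \<Longrightarrow> finite {i \<in> I. p dvd n i}"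
  shows "hopfian G"
  unfolding hopfian_def
proof
  fix f assume f: "f \<in> epi G G"
  then have "f \<in> hom G G"
    unfolding epi_def by blast
  then interpret f: group_hom G G f
    by (simp add: group_hom_def group_hom_axioms_def)
  have "x = \<one>" if x: "x \<in> carrier G" "f x = \<one>" for x
  proof (rule mem_powers_all_imp_one[OF x(1)])
    fix m :: nat assume m: "m > 0"
    let ?N = "(\<lambda>y. y [^] m) ` carrier G"
    have "f ` ?N \<subseteq> ?N"
      using f.hom_nat_pow f.hom_closed by blast
    moreover have "f x \<in> ?N"
      using x subgroup.one_closed[OF subgroup_powers] by simp
    ultimately show "x \<in> ?N"
      using mem_subgroup_if_surj_image_mem[OF f subgroup_powers] finite_rcosets_powers[OF fin m] x(1)
      by blast
  qed
  then show "inj_on f (carrier G)"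
    by (simp add: f.inj_on_one_iff)
qed

end

text \<open>Project the surjection \<open>G \<rightarrow> G \<times>\<times> A\<close> to \<open>G\<close>: the result is injective, so a preimage of \<open>(\<one>, a)\<close>
  is trivial.\<close>

lemma relatively_hopfian_if_hopfian:
  assumes G: "group G" and hopf: "hopfian G"
  shows "relatively_hopfian G"
  unfolding relatively_hopfian_def
proof (intro allI impI)
  fix A :: "'a monoid"
  assume A: "comm_group A" and epi: "epi G (G \<times>\<times> A) \<noteq> {}"
  obtain f where "f \<in> epi G (G \<times>\<times> A)"
    using epi by blast
  then have f: "f \<in> hom G (G \<times>\<times> A)" and surj: "f ` carrier G = carrier (G \<times>\<times> A)"
    unfolding epi_def by simp_all
  interpret G: group G by fact
  interpret A: comm_group A by fact
  have GA: "group (G \<times>\<times> A)"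
    by (rule DirProd_group) (auto simp: G.is_group A.is_group)
  have "fst \<in> hom (G \<times>\<times> A) G"
    by (auto simp: hom_def DirProd_def)
  then have "fst \<circ> f \<in> hom G G"
    using f by (rule hom_compose[rotated])
  moreover have "fst ` carrier (G \<times>\<times> A) = carrier G"
    using A.one_closed by (force simp: DirProd_def)
  ultimately have "fst \<circ> f \<in> epi G G"
    by (simp only: epi_def mem_Collect_eq image_comp[symmetric] surj simp_thms)
  then have inj: "inj_on (fst \<circ> f) (carrier G)"
    using hopf by (simp add: hopfian_def)
  have "a = \<one>\<^bsub>A\<^esub>" if a: "a \<in> carrier A" for a
  proof -
    have "(\<one>\<^bsub>G\<^esub>, a) \<in> f ` carrier G"
      using a by (simp add: surj)
    then obtain x where x: "x \<in> carrier G" "f x = (\<one>\<^bsub>G\<^esub>, a)"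
      by auto
    have f1: "f \<one>\<^bsub>G\<^esub> = (\<one>\<^bsub>G\<^esub>, \<one>\<^bsub>A\<^esub>)"
      using hom_one[OF f G.is_group GA] by simp
    have "x = \<one>\<^bsub>G\<^esub>"
      using x f1 inj_onD[OF inj, of x "\<one>\<^bsub>G\<^esub>"] by simp
    then show ?thesis
      using x f1 by simp
  qed
  then show "trivial_group A"
    using A.is_group by (auto simp: trivial_group_def)
qed

section \<open>Shifting infinitely many summands\<close>

text \<open>Two endomorphisms combine to a map from \<open>G\<close> to \<open>G \<times>\<times> A\<close>, where \<open>A\<close> is the image of \<open>h\<close>. It is onto as
  soon as \<open>f\<close> maps the kernel of \<open>h\<close> onto \<open>G\<close>, since the first component of a preimage can then be corrected
  without changing the second.\<close>

lemma (in comm_group) not_relatively_hopfianI: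
  assumes f: "f \<in> hom G G" and h: "h \<in> hom G G"
    and onto: "f ` kernel G G h = carrier G" and x: "x \<in> carrier G" "h x \<noteq> \<one>"
  shows "\<not> relatively_hopfian G"
proof
  assume hopf: "relatively_hopfian G"
  interpret f: group_hom G G f
    using f by (simp add: group_hom_def group_hom_axioms_def)
  interpret h: group_hom G G h
    using h by (simp add: group_hom_def group_hom_axioms_def)
  let ?A = "G\<lparr>carrier := h ` carrier G\<rparr>"
  have sub: "subgroup (h ` carrier G) G"
    by (rule h.img_is_subgroup)
  have A: "comm_group ?A"
    using subgroup.subset[OF sub]
    by (intro group.group_comm_groupI subgroup.subgroup_is_group[OF sub is_group])
      (auto intro!: m_comm)
  let ?fh = "\<lambda>x. (f x, h x)"
  have "?fh \<in> hom G (G \<times>\<times> ?A)"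
    by (rule homI) (simp_all add: DirProd_def)
  moreover have "?fh ` carrier G = carrier (G \<times>\<times> ?A)"
  proof (rule subset_antisym)
    show "carrier (G \<times>\<times> ?A) \<subseteq> ?fh ` carrier G"
    proof
      fix w assume "w \<in> carrier (G \<times>\<times> ?A)"
      then obtain y z where w: "w = (y, h z)" and y: "y \<in> carrier G" and z: "z \<in> carrier G"
        by (auto simp: DirProd_def)
      have "y \<otimes> inv f z \<in> f ` kernel G G h"
        using onto y z by simp
      then obtain k where k: "k \<in> carrier G" "h k = \<one>" "f k = y \<otimes> inv f z"
        unfolding kernel_def by auto
      have "w = ?fh (k \<otimes> z)"
        using w k y z by (simp add: m_assoc)
      moreover have "k \<otimes> z \<in> carrier G"
        using k(1) z by simp
      ultimately show "w \<in> ?fh ` carrier G"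
        by blast
    qed
  qed (auto simp: DirProd_def)
  ultimately have "epi G (G \<times>\<times> ?A) \<noteq> {}"
    unfolding epi_def by blast
  then have "trivial_group ?A"
    by (rule relatively_hopfian_all_types[OF comm_group_axioms hopf A])
  then have "h ` carrier G = {\<one>}"
    by (simp add: trivial_group_def)
  then show False
    using x by blast
qed

text \<open>Either \<open>v\<close> is constant on an infinite subset, or its infinitely many values can be listed in increasing
  order.\<close>

lemma infinite_imp_mono_sequence:
  fixes v :: "'i \<Rightarrow> nat"
  assumes D: "infinite D"
  obtains s :: "nat \<Rightarrow> 'i" where "inj s" "range s \<subseteq> D" "\<And>j. v (s j) \<le> v (s (Suc j))"
proof (cases "finite (v ` D)")
  case True
  from pigeonhole_infinite[OF D True] obtain a where a: "infinite {i \<in> D. v i = v a}"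
    by blast
  from infinite_countable_subset[OF a] obtain s :: "nat \<Rightarrow> 'i"
    where s: "inj s" "range s \<subseteq> {i \<in> D. v i = v a}"
    by blast
  have "v (s j) = v a" for j
    using s(2) by blast
  then show thesis
    using s by (intro that[of s]) auto
next
  case False
  let ?r = "Infinite_Set.enumerate (v ` D)"
  define s where "s j = inv_into D v (?r j)" for j
  have r: "?r j \<in> v ` D" for j
    using False by (rule enumerate_in_set)
  have vs: "v (s j) = ?r j" for j
    unfolding s_def using r by (rule f_inv_into_f)
  have "strict_mono ?r"
    using False by (rule strict_mono_enumerate)
  then have inj_r: "inj ?r"
    by (rule strict_mono_imp_inj_on)
  show thesis
  proof
    show "inj s"
      by (rule injI) (metis vs inj_r injD)
    show "range s \<subseteq> D"
      unfolding s_def using inv_into_into[OF r] by blast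
    show "v (s j) \<le> v (s (Suc j))" for j
      unfolding vs using enumerate_step[OF False, of j] by simp
  qed
qed

lemma finite_dvd_split_iff:
  fixes n :: "'i \<Rightarrow> nat"
  shows "finite {i \<in> I. p dvd n i} \<longleftrightarrow> finite {i \<in> I. n i = 0} \<and> finite {i \<in> I. n i > 0 \<and> p dvd n i}"
proof -
  have "{i \<in> I. p dvd n i} = {i \<in> I. n i = 0} \<union> {i \<in> I. n i > 0 \<and> p dvd n i}"
    by auto
  then show ?thesis
    by simp
qed

context cyclic_presentation
begin

abbreviation gen :: "'i \<Rightarrow> 'a" where "gen i \<equiv> e (frag_of i)"

lemma gen_closed: "i \<in> I \<Longrightarrow> gen i \<in> carrier G"
  by (simp add: e_closed)

lemma gen_pow_eq_one_iff:
  assumes "i \<in> I"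
  shows "gen i [^] (k::int) = \<one> \<longleftrightarrow> int (n i) dvd k"
proof -
  have "keys (frag_cmul k (frag_of i)) \<subseteq> I"
    using assms keys_cmul[of k "frag_of i"] by auto
  then have "gen i [^] k = \<one> \<longleftrightarrow> (\<forall>j\<in>I. int (n j) dvd lookup (frag_cmul k (frag_of i)) j)"
    using e_eq_one_iff assms by (simp add: e_cmul[symmetric])
  also have "\<dots> \<longleftrightarrow> int (n i) dvd k"
    using assms by (auto simp: lookup_single when_def)
  finally show ?thesis .
qed

lemma gen_pow_eq_iff:
  assumes "i \<in> I"
  shows "gen i [^] (k::int) = gen i [^] (l::int) \<longleftrightarrow> int (n i) dvd k - l"
proof -
  have "gen i [^] k = gen i [^] l \<longleftrightarrow> gen i [^] (k - l) = \<one>"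
    using gen_closed[OF assms] inv_solve_right[of \<one> "gen i [^] k" "gen i [^] l"]
    by (auto simp: int_pow_diff)
  then show ?thesis
    by (simp add: gen_pow_eq_one_iff assms)
qed

lemma subgroup_eq_carrier:
  assumes K: "subgroup K G" and gens: "\<And>i. i \<in> I \<Longrightarrow> gen i \<in> K"
  shows "K = carrier G"
proof
  show "K \<subseteq> carrier G"
    using K by (rule subgroup.subset)
  have eK: "e c \<in> K" if "keys c \<subseteq> I" for c
  proof (rule free_Abelian_group_induct[OF that])
    show "e 0 \<in> K"
      using e.hom_one subgroup.one_closed[OF K] by simp
    show "e (c - d) \<in> K" if "keys c \<subseteq> I" "keys d \<subseteq> I" "e c \<in> K" "e d \<in> K" for c d
      using that K by (simp add: e_diff subgroup.m_closed subgroup.m_inv_closed)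
    show "gen i \<in> K" if "i \<in> I" for i
      using that by (rule gens)
  qed
  show "carrier G \<subseteq> K"
    using e_onto eK by blast
qed

text \<open>Modulo \<open>n (s j)\<close> the integer \<open>z j\<close> is idempotent, so it splits the \<open>s j\<close>-th generator into
  \<open>a j\<close>, its \<open>z j\<close>-th power, and the complementary factor \<open>b j\<close>. By \<open>ord\<close> there is an endomorphism
  that fixes every \<open>b j\<close>, shifts \<open>a (Suc j)\<close> to \<open>a j\<close> and kills \<open>a 0\<close>; it remains onto when restricted to
  the kernel of a second endomorphism that keeps \<open>a 0\<close> and kills all \<open>b j\<close> and \<open>a (Suc j)\<close>. Assumption
  \<open>absorb\<close> says that \<open>a j\<close> is unchanged by the \<open>z (Suc j)\<close>-th power, which makes the shift compatible
  with the two splittings.\<close>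

lemma not_relatively_hopfian_if_shift:
  fixes s :: "nat \<Rightarrow> 'i" and z :: "nat \<Rightarrow> int"
  assumes s: "inj s" "range s \<subseteq> I"
    and idem: "\<And>j. int (n (s j)) dvd z j * (z j - 1)"
    and absorb: "\<And>j. int (n (s j)) dvd z j * (z (Suc j) - 1)"
    and ord: "\<And>j. int (n (s j)) dvd int (n (s (Suc j))) * z j"
    and nontriv: "\<not> int (n (s 0)) dvd z 0"
  shows "\<not> relatively_hopfian G"
proof -
  define a where "a j = gen (s j) [^] z j" for j
  define b where "b j = gen (s j) [^] (1 - z j)" for j
  have sI: "s j \<in> I" for j
    using s(2) by blast
  note gen_s = gen_closed[OF sI]
  have closed: "a j \<in> carrier G" "b j \<in> carrier G" for j
    using gen_s by (simp_all add: a_def b_def)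
  have a_mult_b: "b j \<otimes> a j = gen (s j)" for j
    using gen_s[of j] by (simp add: a_def b_def int_pow_mult[symmetric])
  have pow: "a j [^] k = gen (s j) [^] (z j * k)" "b j [^] k = gen (s j) [^] ((1 - z j) * k)"
    for j and k :: int
    using gen_s[of j] by (simp_all add: a_def b_def int_pow_pow)
  have b_idem: "b j [^] (1 - z j) = b j" for j
    unfolding pow using idem[of j] by (simp add: b_def gen_pow_eq_iff sI algebra_simps)
  have a_b: "a j [^] (1 - z j) = \<one>" and b_a: "b j [^] z j = \<one>" for j
    unfolding pow using idem[of j] by (simp_all add: gen_pow_eq_one_iff sI algebra_simps dvd_diff_commute)
  have a_Suc: "a j [^] z (Suc j) = a j" for j
    unfolding pow using absorb[of j] by (simp add: a_def gen_pow_eq_iff sI algebra_simps)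
  have a_b_Suc: "a j [^] (1 - z (Suc j)) = \<one>" for j
    unfolding pow using absorb[of j] by (simp add: gen_pow_eq_one_iff sI algebra_simps dvd_diff_commute)
  \<comment> \<open>\<open>f\<close> is the shift, given on generators by \<open>u\<close>; \<open>h\<close>, given by \<open>t\<close>, is the projection to \<open>a 0\<close>\<close>
  define w where "w j = (case j of 0 \<Rightarrow> b 0 | Suc k \<Rightarrow> b (Suc k) \<otimes> a k)" for j
  define u where "u i = (if i \<in> range s then w (inv_into UNIV s i) else gen i)" for i
  define t where "t i = (if i = s 0 then a 0 else \<one>)" for i
  have w_closed: "w j \<in> carrier G" for j
    using closed by (simp add: w_def split: nat.split)
  have b_ord: "b j [^] n (s j) = \<one>" for j
    using pow(2)[of j "int (n (s j))"] by (simp add: int_pow_int gen_pow_eq_one_iff sI)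
  have a_ord: "a j [^] n (s j) = \<one>" for j
    using pow(1)[of j "int (n (s j))"] by (simp add: int_pow_int gen_pow_eq_one_iff sI)
  have a_ord_Suc: "a j [^] n (s (Suc j)) = \<one>" for j
    using pow(1)[of j "int (n (s (Suc j)))"] ord[of j]
    by (simp add: int_pow_int gen_pow_eq_one_iff sI mult.commute)
  have w_ord: "w j [^] n (s j) = \<one>" for j
  proof (cases j)
    case 0
    then show ?thesis
      using b_ord[of 0] by (simp add: w_def)
  next
    case (Suc k)
    then show ?thesis
      using b_ord[of j] a_ord_Suc[of k] closed by (simp add: w_def nat_pow_distrib)
  qed
  have gen_ord: "gen i [^] n i = \<one>" if "i \<in> I" for i
    using gen_pow_eq_one_iff[OF that, of "int (n i)"] by (simp add: int_pow_int)
  have us: "u (s j) = w j" for j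
    using s(1) by (simp add: u_def)
  have ts: "t (s 0) = a 0" "t (s (Suc j)) = \<one>" for j
    using s(1) by (simp_all add: t_def inj_eq)
  have u: "u i \<in> carrier G \<and> u i [^] n i = \<one>" if i: "i \<in> I" for i
  proof (cases "i \<in> range s")
    case True
    then obtain j where "i = s j"
      by blast
    then show ?thesis
      using us w_closed w_ord by simp
  next
    case False
    then show ?thesis
      using gen_closed[OF i] gen_ord[OF i] by (simp add: u_def)
  qed
  obtain f where f: "f \<in> hom G G" and fu: "\<And>i. i \<in> I \<Longrightarrow> f (gen i) = u i"
    using hom_extension[OF comm_group_axioms, of u] u by blast
  have t: "t i \<in> carrier G \<and> t i [^] n i = \<one>" for i
    using closed a_ord[of 0] by (simp add: t_def)
  obtain h where h: "h \<in> hom G G" and ht: "\<And>i. i \<in> I \<Longrightarrow> h (gen i) = t i"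
    using hom_extension[OF comm_group_axioms, of t] t by blast
  interpret f: group_hom G G f
    using f by (simp add: group_hom_def group_hom_axioms_def)
  interpret h: group_hom G G h
    using h by (simp add: group_hom_def group_hom_axioms_def)
  have f_gen: "f (gen (s j) [^] k) = w j [^] k" for j and k :: int
    using gen_s by (simp add: f.hom_int_pow fu sI us)
  have h_gen: "h (gen (s j) [^] k) = t (s j) [^] k" for j and k :: int
    using gen_s by (simp add: h.hom_int_pow ht sI)
  let ?K = "f ` kernel G G h"
  have K: "subgroup ?K G"
    using f.subgroup_img_is_subgroup[OF h.subgroup_kernel] .
  have K_I: "f x \<in> ?K" if "x \<in> carrier G" "h x = \<one>" for x
    using that by (simp add: kernel_def)
  have aK: "a j \<in> ?K" for j
  proof -
    have "f (a (Suc j)) = b (Suc j) [^] z (Suc j) \<otimes> a j [^] z (Suc j)"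
      using closed by (simp add: a_def[of "Suc j"] f_gen w_def int_pow_distrib)
    then have "f (a (Suc j)) = a j"
      using closed by (simp add: b_a a_Suc)
    moreover have "h (a (Suc j)) = \<one>"
      by (simp add: a_def h_gen ts)
    ultimately show ?thesis
      using K_I[OF closed(1), of "Suc j"] by simp
  qed
  have bK: "b j \<in> ?K" for j
  proof (cases j)
    case 0
    have "f (b 0) = b 0"
      by (simp only: b_def[of 0] f_gen) (simp add: w_def b_idem flip: b_def)
    moreover have "h (b 0) = \<one>"
      by (simp add: b_def h_gen ts a_b)
    ultimately show ?thesis
      using K_I[OF closed(2), of 0] 0 by simp
  next
    case (Suc k)
    have "f (b (Suc k)) = b (Suc k) [^] (1 - z (Suc k)) \<otimes> a k [^] (1 - z (Suc k))"
      using closed by (simp only: b_def[of "Suc k"] f_gen) (simp add: w_def int_pow_distrib flip: b_def)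
    then have "f (b (Suc k)) = b (Suc k)"
      using closed by (simp add: b_idem a_b_Suc)
    moreover have "h (b (Suc k)) = \<one>"
      by (simp add: b_def h_gen ts)
    ultimately show ?thesis
      using K_I[OF closed(2), of "Suc k"] Suc by simp
  qed
  have "gen i \<in> ?K" if i: "i \<in> I" for i
  proof (cases "i \<in> range s")
    case True
    then obtain j where "i = s j"
      by blast
    then show ?thesis
      using subgroup.m_closed[OF K bK aK, of j j] by (simp add: a_mult_b)
  next
    case False
    then have "f (gen i) = gen i" "h (gen i) = \<one>"
      using i fu[OF i] ht[OF i] by (auto simp: u_def t_def)
    then show ?thesis
      using K_I[OF gen_closed[OF i]] by simp
  qed
  then have "?K = carrier G"
    by (rule subgroup_eq_carrier[OF K])
  moreover have "h (gen (s 0)) \<noteq> \<one>"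
    using nontriv by (simp add: ht sI ts a_def gen_pow_eq_one_iff)
  ultimately show ?thesis
    using not_relatively_hopfianI[OF f h] gen_s by blast
qed

text \<open>Infinitely many infinite cyclic summands can be shifted as they are. Otherwise infinitely many finite
  summands have order divisible by \<open>p\<close>; list some of them so that the \<open>p\<close>-parts of their orders do not
  decrease, and shift the \<open>p\<close>-primary components. The exponent \<open>z j\<close> that projects to the \<open>p\<close>-primary
  component comes from the Chinese remainder theorem: it is \<open>1\<close> modulo the \<open>p\<close>-part \<open>q j\<close> of the order and
  \<open>0\<close> modulo the complementary part.\<close>

lemma finite_dvd_if_relatively_hopfian:
  assumes hopf: "relatively_hopfian G" and p: "Factorial_Ring.prime p"
  shows "finite {i \<in> I. p dvd n i}"
proof (rule ccontr)
  assume "infinite {i \<in> I. p dvd n i}"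
  then have "infinite {i \<in> I. n i = 0} \<or> infinite {i \<in> I. n i > 0 \<and> p dvd n i}"
    by (simp add: finite_dvd_split_iff)
  then show False
  proof
    assume "infinite {i \<in> I. n i = 0}"
    from infinite_countable_subset[OF this] obtain s :: "nat \<Rightarrow> 'i"
      where s: "inj s" "range s \<subseteq> {i \<in> I. n i = 0}"
      by blast
    have "n (s j) = 0" for j
      using s(2) by blast
    then show False
      using not_relatively_hopfian_if_shift[of s "\<lambda>_. 1"] s hopf by auto
  next
    assume "infinite {i \<in> I. n i > 0 \<and> p dvd n i}"
    then obtain s :: "nat \<Rightarrow> 'i" where s: "inj s" "range s \<subseteq> {i \<in> I. n i > 0 \<and> p dvd n i}"
      and mono: "\<And>j. multiplicity p (n (s j)) \<le> multiplicity p (n (s (Suc j)))"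
      by (rule infinite_imp_mono_sequence[where v = "\<lambda>i. multiplicity p (n i)"]) auto
    define q where "q j = int (p ^ multiplicity p (n (s j)))" for j
    have ns: "n (s j) > 0" "p dvd n (s j)" for j
      using s(2) by blast+
    have "\<exists>m z. int (n (s j)) = q j * m \<and> q j dvd z - 1 \<and> m dvd z" for j
    proof -
      have "\<not> is_unit p"
        using p not_prime_unit by blast
      then obtain m where m: "n (s j) = p ^ multiplicity p (n (s j)) * m" "\<not> p dvd m"
        using multiplicity_decompose'[of "n (s j)" p] ns(1)[of j] by auto
      have "coprime (p ^ multiplicity p (n (s j))) m"
        using m(2) p by (simp add: prime_imp_coprime)
      then have "gcd (q j) (int m) = 1"
        unfolding q_def by (simp add: coprime_iff_gcd_eq_1 flip: of_nat_power)
      then obtain k l where kl: "k * q j + l * int m = 1"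
        using bezout_int[of "q j" "int m"] by auto
      then have "l * int m - 1 = q j * - k"
        by (simp add: algebra_simps)
      then have "q j dvd l * int m - 1"
        by (rule dvdI)
      moreover have "int (n (s j)) = q j * int m"
        unfolding q_def by (metis m(1) of_nat_mult)
      ultimately show ?thesis
        by (intro exI[of _ "int m"] exI[of _ "l * int m"]) simp
    qed
    then have "\<forall>j. \<exists>z m. int (n (s j)) = q j * m \<and> q j dvd z - 1 \<and> m dvd z"
      by blast
    from choice[OF this] obtain z where
      "\<forall>j. \<exists>m. int (n (s j)) = q j * m \<and> q j dvd z j - 1 \<and> m dvd z j" ..
    from choice[OF this] obtain m where
      "\<forall>j. int (n (s j)) = q j * m j \<and> q j dvd z j - 1 \<and> m j dvd z j" ..
    then have nm: "\<And>j. int (n (s j)) = q j * m j" and qz: "\<And>j. q j dvd z j - 1"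
      and mz: "\<And>j. m j dvd z j"
      by simp_all
    have q_Suc: "q j dvd q (Suc j)" for j
      unfolding q_def using mono[of j] by (simp add: le_imp_power_dvd)
    have "\<not> relatively_hopfian G"
    proof (rule not_relatively_hopfian_if_shift)
      show "inj s" "range s \<subseteq> I"
        using s by auto
      fix j
      show "int (n (s j)) dvd z j * (z j - 1)"
        unfolding nm using mult_dvd_mono[OF mz[of j] qz[of j]] by (simp add: mult.commute)
      have "q j dvd z (Suc j) - 1"
        using q_Suc qz by (rule dvd_trans)
      then have "m j * q j dvd z j * (z (Suc j) - 1)"
        by (rule mult_dvd_mono[OF mz])
      then show "int (n (s j)) dvd z j * (z (Suc j) - 1)"
        unfolding nm by (simp add: mult.commute)
      have "q j dvd int (n (s (Suc j)))"
        unfolding nm using q_Suc by (rule dvd_mult2)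
      then show "int (n (s j)) dvd int (n (s (Suc j))) * z j"
        unfolding nm[of j] by (rule mult_dvd_mono[OF _ mz])
    next
      have "int p dvd z 0 - 1"
      proof -
        have "multiplicity p (n (s 0)) > 0"
          using ns[of 0] p by (simp add: prime_multiplicity_gt_zero_iff)
        then have "p dvd p ^ multiplicity p (n (s 0))"
          by (intro dvd_power) simp
        then have "int p dvd q 0"
          unfolding q_def by (simp only: int_dvd_int_iff)
        then show ?thesis
          using qz by (rule dvd_trans)
      qed
      moreover have "int p dvd int (n (s 0))"
        using ns(2) by simp
      ultimately have "int p dvd z 0 - (z 0 - 1)" if "int (n (s 0)) dvd z 0"
        using dvd_diff[OF dvd_trans[OF _ that]] by blast
      moreover have "\<not> int p dvd 1"
        using p by (auto simp: prime_nat_iff)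
      ultimately show "\<not> int (n (s 0)) dvd z 0"
        by auto
    qed
    then show False
      using hopf by blast
  qed
qed

end

section \<open>The rank of the torsion-free part\<close>

context cyclic_presentation
begin

lemma lookup_eq_0_if_torsion:
  assumes c: "keys c \<subseteq> I" "e c \<in> torsion_part G" and i: "i \<in> I" "n i = 0"
  shows "lookup c i = 0"
proof -
  obtain m :: nat where m: "m > 0" "e c [^] m = \<one>"
    using c(2) unfolding torsion_part_def by blast
  have "keys (frag_cmul (int m) c) \<subseteq> I"
    using c(1) keys_cmul[of "int m" c] by blast
  then have "int (n i) dvd lookup (frag_cmul (int m) c) i"
    using e_eq_one_iff[of "frag_cmul (int m) c"] m(2) i(1) by (auto simp: e_cmul_nat c(1))
  then show ?thesis
    using m(1) i(2) by simp
qed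

lemma gen_torsion:
  assumes "i \<in> I" "n i > 0"
  shows "gen i \<in> torsion_part G"
proof -
  have "gen i [^] n i = \<one>"
    using gen_pow_eq_one_iff[OF assms(1), of "int (n i)"] by (simp add: int_pow_int)
  then show ?thesis
    using assms gen_closed unfolding torsion_part_def by blast
qed

text \<open>Here \<open>B\<close> is a basis of the torsion-free quotient. If there are finitely many infinite summands, then
  finitely many generators survive in the quotient, and their supports cover \<open>B\<close>. Conversely, the generators
  of the infinite summands stay distinct in the quotient modulo \<open>2\<close>, which is finite when \<open>B\<close> is: the
  difference of two of them has an odd coordinate in \<open>G\<close>, hence is not the double of an element modulo torsion.\<close>

lemma finite_infinite_cyclic_iff:
  assumes r: "r \<in> epi G (free_Abelian_group B)"
    and ker: "\<And>x. x \<in> carrier G \<Longrightarrow> r x = 0 \<longleftrightarrow> x \<in> torsion_part G"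
  shows "finite {i \<in> I. n i = 0} \<longleftrightarrow> finite B"
proof -
  let ?J = "{i \<in> I. n i = 0}"
  have r_hom: "r \<in> hom G (free_Abelian_group B)" and r_onto: "r ` carrier G = carrier (free_Abelian_group B)"
    using r unfolding epi_def by simp_all
  have re: "r \<circ> e \<in> hom (free_Abelian_group I) (free_Abelian_group B)"
    using Group.hom_compose[OF e_hom r_hom] .
  have re_keys: "keys (r (e c)) \<subseteq> B" if "keys c \<subseteq> I" for c
    using hom_in_carrier[OF re, of c] that by simp
  have re_diff: "r (e (c - d)) = r (e c) - r (e d)" if "keys c \<subseteq> I" "keys d \<subseteq> I" for c d
    using hom_frag_diff[OF re that] by simp
  have re_onto: "\<exists>c. keys c \<subseteq> I \<and> r (e c) = z" if z: "keys z \<subseteq> B" for z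
  proof -
    have "z \<in> r ` carrier G"
      using z r_onto by simp
    then show ?thesis
      using e_onto by blast
  qed
  have re_double: "r (e (frag_cmul 2 c)) = r (e c) + r (e c)" if "keys c \<subseteq> I" for c
  proof -
    have "frag_cmul 2 c = c + c"
      by (rule poly_mapping_eqI) (simp add: lookup_add)
    then show ?thesis
      using hom_frag_add[OF re that that] by simp
  qed
  show ?thesis
  proof
    assume J: "finite ?J"
    let ?U = "\<Union>i\<in>?J. keys (r (gen i))"
    have in_U: "keys (r (e c)) \<subseteq> ?U" if "keys c \<subseteq> I" for c
    proof (rule free_Abelian_group_induct[OF that])
      have "r \<one> = 0"
        using ker[OF one_closed] unfolding torsion_part_def by auto
      then show "keys (r (e 0)) \<subseteq> ?U"
        using e.hom_one by simp
      show "keys (r (e (c - d))) \<subseteq> ?U" if "keys c \<subseteq> I" "keys d \<subseteq> I"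
        "keys (r (e c)) \<subseteq> ?U" "keys (r (e d)) \<subseteq> ?U" for c d
        using that keys_diff[of "r (e c)" "r (e d)"] unfolding re_diff[OF that(1,2)] by blast
      show "keys (r (gen i)) \<subseteq> ?U" if "i \<in> I" for i
      proof (cases "n i = 0")
        case True
        then show ?thesis
          using that by blast
      next
        case False
        then have "r (gen i) = 0"
          using ker[OF gen_closed] gen_torsion that by simp
        then show ?thesis
          by simp
      qed
    qed
    have "B \<subseteq> ?U"
    proof
      fix b assume "b \<in> B"
      then obtain c where "keys c \<subseteq> I" "r (e c) = frag_of b"
        using re_onto[of "frag_of b"] by auto
      then show "b \<in> ?U"
        using in_U[of c] by simp
    qed
    moreover have "finite ?U"
      using J by simp
    ultimately show "finite B"
      by (rule finite_subset)
  next
    assume B: "finite B"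
    let ?odd = "\<lambda>i. {b \<in> B. odd (lookup (r (gen i)) b)}"
    have "inj_on ?odd ?J"
    proof (rule inj_onI, rule ccontr)
      fix i j assume i: "i \<in> ?J" and j: "j \<in> ?J" and same: "?odd i = ?odd j" and "i \<noteq> j"
      let ?d = "frag_of i - frag_of j"
      have d: "keys ?d \<subseteq> I"
        using i j keys_diff[of "frag_of i" "frag_of j"] by auto
      have rd: "r (e ?d) = r (gen i) - r (gen j)"
        using i j by (simp add: re_diff)
      \<comment> \<open>equal parities make the difference of the images a double \<open>z + z\<close>\<close>
      obtain z where z: "keys z \<subseteq> B"
        "\<And>b. lookup z b = (if b \<in> B then lookup (r (e ?d)) b div 2 else 0)"
        by (rule ex_poly_mapping[OF B, where f = "\<lambda>b. lookup (r (e ?d)) b div 2"]) auto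
      have even: "even (lookup (r (e ?d)) b)" if "b \<in> B" for b
        using same that unfolding rd lookup_minus by auto
      have "r (e ?d) = z + z"
      proof (rule poly_mapping_eqI)
        fix b
        show "lookup (r (e ?d)) b = lookup (z + z) b"
        proof (cases "b \<in> B")
          case True
          then show ?thesis
            using even[OF True] z(2)[of b] by (simp add: lookup_add)
        next
          case False
          then have "b \<notin> keys (r (e ?d))"
            using re_keys[OF d] by blast
          then show ?thesis
            using z(2)[of b] False by (simp add: lookup_add in_keys_iff)
        qed
      qed
      obtain c where c: "keys c \<subseteq> I" "r (e c) = z"
        using re_onto[OF z(1)] by blast
      have c2: "keys (frag_cmul 2 c) \<subseteq> I"
        using c(1) keys_cmul[of 2 c] by blast
      have dc: "keys (?d - frag_cmul 2 c) \<subseteq> I"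
        using d c2 keys_diff[of ?d "frag_cmul 2 c"] by blast
      have "r (e (?d - frag_cmul 2 c)) = 0"
        using \<open>r (e ?d) = z + z\<close> c by (simp add: re_diff[OF d c2] re_double)
      then have "e (?d - frag_cmul 2 c) \<in> torsion_part G"
        using ker[OF e_closed[OF dc]] by blast
      then have "lookup (?d - frag_cmul 2 c) i = 0"
        using i by (intro lookup_eq_0_if_torsion[OF dc]) auto
      then have "1 - 2 * lookup c i = 0"
        using \<open>i \<noteq> j\<close> by (simp add: lookup_minus)
      then show False
        by presburger
    qed
    moreover have "finite (?odd ` ?J)"
      by (rule finite_subset[of _ "Pow B"]) (use B in auto)
    ultimately show "finite ?J"
      by (rule finite_imageD[rotated])
  qed
qed

end

text \<open>The projection to the first summand is the link between a given complement of the torsion subgroup and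
  the quotient by it, which the cyclic decomposition can see.\<close>

lemma internal_direct_sum_projection:
  assumes G: "comm_group G" and sum: "internal_direct_sum G F T"
    and H: "group H" and \<theta>: "\<theta> \<in> iso (G\<lparr>carrier := F\<rparr>) H"
  obtains r where "r \<in> epi G H" "\<And>x. x \<in> carrier G \<Longrightarrow> r x = \<one>\<^bsub>H\<^esub> \<longleftrightarrow> x \<in> T"
proof -
  interpret G: comm_group G by fact
  have F: "subgroup F G" and T: "subgroup T G" and disj: "F \<inter> T = {\<one>\<^bsub>G\<^esub>}"
    and whole: "F <#>\<^bsub>G\<^esub> T = carrier G"
    using sum unfolding internal_direct_sum_def by simp_all
  note FG = subgroup.mem_carrier[OF F] and TG = subgroup.mem_carrier[OF T]
  have \<theta>_hom: "\<theta> \<in> hom (G\<lparr>carrier := F\<rparr>) H" and \<theta>_bij: "bij_betw \<theta> F (carrier H)"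
    using \<theta> unfolding iso_def by simp_all
  interpret \<theta>: group_hom "G\<lparr>carrier := F\<rparr>" H \<theta>
    using \<theta>_hom H subgroup.subgroup_is_group[OF F G.is_group]
    by (simp add: group_hom_def group_hom_axioms_def)
  have split: "\<exists>f t. f \<in> F \<and> t \<in> T \<and> x = f \<otimes>\<^bsub>G\<^esub> t" if "x \<in> carrier G" for x
    using that unfolding whole[symmetric] set_mult_def by blast
  have unique: "f = f'"
    if "f \<in> F" "t \<in> T" "f' \<in> F" "t' \<in> T" "f \<otimes>\<^bsub>G\<^esub> t = f' \<otimes>\<^bsub>G\<^esub> t'" for f t f' t'
  proof -
    note carr = FG[OF that(1)] TG[OF that(2)] FG[OF that(3)] TG[OF that(4)]
    have "f = (f' \<otimes>\<^bsub>G\<^esub> t') \<otimes>\<^bsub>G\<^esub> inv\<^bsub>G\<^esub> t"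
      using carr by (simp add: G.m_assoc flip: that(5))
    then have "inv\<^bsub>G\<^esub> f' \<otimes>\<^bsub>G\<^esub> f = t' \<otimes>\<^bsub>G\<^esub> inv\<^bsub>G\<^esub> t"
      using carr by (simp add: G.m_assoc[symmetric])
    moreover have "inv\<^bsub>G\<^esub> f' \<otimes>\<^bsub>G\<^esub> f \<in> F"
      using that F by (simp add: subgroup.m_closed subgroup.m_inv_closed)
    moreover have "t' \<otimes>\<^bsub>G\<^esub> inv\<^bsub>G\<^esub> t \<in> T"
      using that T by (simp add: subgroup.m_closed subgroup.m_inv_closed)
    ultimately have "inv\<^bsub>G\<^esub> f' \<otimes>\<^bsub>G\<^esub> f = \<one>\<^bsub>G\<^esub>"
      using disj by auto
    then show ?thesis
      using carr G.inv_solve_left'[of "\<one>\<^bsub>G\<^esub>" f' f] by simp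
  qed
  define r where "r x = \<theta> (SOME f. f \<in> F \<and> (\<exists>t\<in>T. x = f \<otimes>\<^bsub>G\<^esub> t))" for x
  have r: "r (f \<otimes>\<^bsub>G\<^esub> t) = \<theta> f" if ft: "f \<in> F" "t \<in> T" for f t
  proof -
    have "(SOME f'. f' \<in> F \<and> (\<exists>t'\<in>T. f \<otimes>\<^bsub>G\<^esub> t = f' \<otimes>\<^bsub>G\<^esub> t')) = f"
    proof (rule some_equality)
      show "f \<in> F \<and> (\<exists>t'\<in>T. f \<otimes>\<^bsub>G\<^esub> t = f \<otimes>\<^bsub>G\<^esub> t')"
        using ft by blast
      show "f' = f" if "f' \<in> F \<and> (\<exists>t'\<in>T. f \<otimes>\<^bsub>G\<^esub> t = f' \<otimes>\<^bsub>G\<^esub> t')" for f'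
        using unique[OF ft] that by blast
    qed
    then show ?thesis
      by (simp add: r_def)
  qed
  have r_hom: "r \<in> hom G H"
  proof (rule homI)
    fix x assume "x \<in> carrier G"
    then obtain f t where "f \<in> F" "t \<in> T" "x = f \<otimes>\<^bsub>G\<^esub> t"
      using split by blast
    then show "r x \<in> carrier H"
      using \<theta>.hom_closed by (simp add: r)
  next
    fix x y assume "x \<in> carrier G" "y \<in> carrier G"
    then obtain f t f' t' where ft: "f \<in> F" "t \<in> T" "f' \<in> F" "t' \<in> T"
      and xy: "x = f \<otimes>\<^bsub>G\<^esub> t" "y = f' \<otimes>\<^bsub>G\<^esub> t'"
      using split[of x] split[of y] by blast
    have "x \<otimes>\<^bsub>G\<^esub> y = (f \<otimes>\<^bsub>G\<^esub> f') \<otimes>\<^bsub>G\<^esub> (t \<otimes>\<^bsub>G\<^esub> t')"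
      using ft by (simp add: xy FG TG G.m_ac)
    then show "r (x \<otimes>\<^bsub>G\<^esub> y) = r x \<otimes>\<^bsub>H\<^esub> r y"
      using ft \<theta>.hom_mult[of f f'] by (simp add: xy r subgroup.m_closed[OF F] subgroup.m_closed[OF T])
  qed
  show thesis
  proof
    have "carrier H \<subseteq> r ` carrier G"
    proof
      fix h assume "h \<in> carrier H"
      then obtain f where f: "f \<in> F" "h = \<theta> f"
        using \<theta>_bij unfolding bij_betw_def by blast
      then have "h = r f"
        using r[OF f(1) subgroup.one_closed[OF T]] by (simp add: FG)
      then show "h \<in> r ` carrier G"
        using FG[OF f(1)] by blast
    qed
    then show "r \<in> epi G H"
      using r_hom hom_carrier[OF r_hom] unfolding epi_def by blast
    fix x assume "x \<in> carrier G"
    then obtain f t where ft: "f \<in> F" "t \<in> T" "x = f \<otimes>\<^bsub>G\<^esub> t"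
      using split by blast
    have oneF: "\<one>\<^bsub>G\<^esub> \<in> F"
      by (rule subgroup.one_closed[OF F])
    have \<theta>1: "\<theta> \<one>\<^bsub>G\<^esub> = \<one>\<^bsub>H\<^esub>"
      using \<theta>.hom_one by simp
    show "r x = \<one>\<^bsub>H\<^esub> \<longleftrightarrow> x \<in> T"
    proof
      assume "r x = \<one>\<^bsub>H\<^esub>"
      then have "\<theta> f = \<theta> \<one>\<^bsub>G\<^esub>"
        using ft r \<theta>1 by simp
      then have "f = \<one>\<^bsub>G\<^esub>"
        using \<theta>_bij ft(1) oneF unfolding bij_betw_def inj_on_def by blast
      then show "x \<in> T"
        using ft TG by simp
    next
      assume x: "x \<in> T"
      then show "r x = \<one>\<^bsub>H\<^esub>"
        using r[OF oneF x] \<theta>1 TG by simp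
    qed
  qed
qed

section \<open>The ranks of the primary components\<close>

text \<open>There are only finitely many coefficient functions on a finite basis.\<close>

lemma finite_if_Fp_basis:
  assumes "finite B" "Fp_basis p V B"
  shows "finite (carrier V)"
proof (rule finite_subset)
  let ?C = "{c :: 'a \<Rightarrow> nat. \<forall>b. (b \<in> B \<longrightarrow> c b \<in> {..<p}) \<and> (b \<notin> B \<longrightarrow> c b = 0)}"
  let ?comb = "\<lambda>c. \<Otimes>\<^bsub>V\<^esub>b\<in>{b. c b \<noteq> 0}. b [^]\<^bsub>V\<^esub> (c b :: nat)"
  show "carrier V \<subseteq> ?comb ` ?C"
  proof
    fix x assume "x \<in> carrier V"
    then obtain c :: "'a \<Rightarrow> nat" where c: "\<forall>b. c b < p" "{b. c b \<noteq> 0} \<subseteq> B" "x = ?comb c"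
      using assms(2) unfolding Fp_basis_def by blast
    have "c \<in> ?C"
      using c(1,2) by auto
    then show "x \<in> ?comb ` ?C"
      using c(3) by blast
  qed
  show "finite (?comb ` ?C)"
    by (intro finite_imageI finite_set_of_finite_funs assms(1)) simp
qed

lemma (in comm_group) finprod_subgroup:
  assumes H: "subgroup H G" and f: "\<And>a. a \<in> A \<Longrightarrow> f a \<in> H"
  shows "finprod (G\<lparr>carrier := H\<rparr>) f A = finprod G f A"
proof -
  have HG: "h \<in> carrier G" if "h \<in> H" for h
    using subgroup.mem_carrier[OF H that] .
  interpret H: comm_group "G\<lparr>carrier := H\<rparr>"
    by (intro group.group_comm_groupI subgroup.subgroup_is_group[OF H is_group])
      (auto intro!: m_comm HG)
  show ?thesis
    using f
  proof (induction A rule: infinite_finite_induct)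
    case (insert a A)
    have "finprod (G\<lparr>carrier := H\<rparr>) f (insert a A) = f a \<otimes> finprod (G\<lparr>carrier := H\<rparr>) f A"
      using insert H.finprod_insert[of A a f] by simp
    also have "\<dots> = finprod G f (insert a A)"
      using insert HG by (subst finprod_insert) auto
    finally show ?case .
  qed simp_all
qed

lemma (in comm_group) subgroup_socle: "subgroup (socle G p) G"
proof (rule subgroupI)
  show "socle G p \<subseteq> carrier G"
    unfolding socle_def by blast
  have "\<one> \<in> socle G p"
    unfolding socle_def by simp
  then show "socle G p \<noteq> {}"
    by blast
  show "inv a \<in> socle G p" if "a \<in> socle G p" for a
    using that unfolding socle_def by (simp add: nat_pow_inv)
  show "a \<otimes> b \<in> socle G p" if "a \<in> socle G p" "b \<in> socle G p" for a b
    using that unfolding socle_def by (simp add: nat_pow_distrib)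
qed

text \<open>An element killed by \<open>p\<close> is automatically a \<open>p\<close>-primary torsion element, so the socle may be taken in
  the whole group.\<close>

lemma socle_primary_part_torsion_part:
  assumes "Factorial_Ring.prime p"
  shows "G\<lparr>carrier := primary_part (G\<lparr>carrier := torsion_part G\<rparr>) p,
      carrier := socle (G\<lparr>carrier := primary_part (G\<lparr>carrier := torsion_part G\<rparr>) p\<rparr>) p\<rparr> =
    G\<lparr>carrier := socle G p\<rparr>"
proof -
  have pow: "x [^]\<^bsub>G\<lparr>carrier := H\<rparr>\<^esub> k = x [^]\<^bsub>G\<^esub> k" for x H and k :: nat
    by (simp add: nat_pow_def)
  have "p > 0"
    using assms prime_gt_0_nat by blast
  have "x \<in> torsion_part G \<and> (\<exists>k::nat. x [^]\<^bsub>G\<^esub> (p ^ k) = \<one>\<^bsub>G\<^esub>)" if "x \<in> carrier G" "x [^]\<^bsub>G\<^esub> p = \<one>\<^bsub>G\<^esub>" for x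
  proof
    show "x \<in> torsion_part G"
      using that \<open>p > 0\<close> unfolding torsion_part_def by blast
    show "\<exists>k::nat. x [^]\<^bsub>G\<^esub> (p ^ k) = \<one>\<^bsub>G\<^esub>"
      using that(2) by (intro exI[of _ 1]) simp
  qed
  then have "socle (G\<lparr>carrier := primary_part (G\<lparr>carrier := torsion_part G\<rparr>) p\<rparr>) p = socle G p"
    unfolding socle_def primary_part_def by (auto simp: pow torsion_part_def)
  then show ?thesis
    by simp
qed

context cyclic_presentation
begin

lemma e_eq_finprod:
  assumes S: "finite S" "S \<subseteq> I" and c: "keys c \<subseteq> S"
  shows "e c = (\<Otimes>i\<in>S. gen i [^] lookup c i)"
proof -
  have sum: "keys (\<Sum>i\<in>S. frag_cmul (lookup c i) (frag_of i)) \<subseteq> I \<and>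
      e (\<Sum>i\<in>S. frag_cmul (lookup c i) (frag_of i)) = (\<Otimes>i\<in>S. gen i [^] lookup c i)"
    using S
  proof (induction S rule: finite_induct)
    case empty
    then show ?case
      using e.hom_one by simp
  next
    case (insert i S)
    let ?a = "frag_cmul (lookup c i) (frag_of i)"
    let ?b = "\<Sum>i\<in>S. frag_cmul (lookup c i) (frag_of i)"
    have a: "keys ?a \<subseteq> I"
      using insert.prems keys_cmul[of "lookup c i" "frag_of i"] by auto
    have b: "keys ?b \<subseteq> I" "e ?b = (\<Otimes>i\<in>S. gen i [^] lookup c i)"
      using insert by simp_all
    have "keys (?a + ?b) \<subseteq> I"
      using a b(1) keys_add[of ?a ?b] by blast
    moreover have "e (?a + ?b) = gen i [^] lookup c i \<otimes> (\<Otimes>i\<in>S. gen i [^] lookup c i)"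
      using a b insert.prems by (simp add: e_add e_cmul)
    moreover have "(\<lambda>i. gen i [^] lookup c i) \<in> S \<rightarrow> carrier G" "gen i [^] lookup c i \<in> carrier G"
      using insert.prems gen_closed by auto
    ultimately show ?case
      using insert.hyps by simp
  qed
  have "(\<Sum>i\<in>S. frag_cmul (lookup c i) (frag_of i)) = c"
  proof (rule poly_mapping_eqI)
    fix j
    have "lookup (\<Sum>i\<in>S. frag_cmul (lookup c i) (frag_of i)) j =
        (\<Sum>i\<in>S. if j = i then lookup c i else 0)"
      unfolding lookup_sum by (intro sum.cong refl) simp
    also have "\<dots> = lookup c j"
      using S(1) c by (auto simp: in_keys_iff)
    finally show "lookup (\<Sum>i\<in>S. frag_cmul (lookup c i) (frag_of i)) j = lookup c j" .
  qed
  with sum show ?thesis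
    by simp
qed

lemma e_in_socle_iff:
  assumes "keys c \<subseteq> I"
  shows "e c \<in> socle G p \<longleftrightarrow> (\<forall>i\<in>I. int (n i) dvd int p * lookup c i)"
proof -
  have "keys (frag_cmul (int p) c) \<subseteq> I"
    using assms keys_cmul[of "int p" c] by blast
  then show ?thesis
    using e_eq_one_iff[of "frag_cmul (int p) c"] e_closed[OF assms]
    by (simp add: socle_def e_cmul_nat assms)
qed

text \<open>A summand of finite order \<open>n i\<close> divisible by \<open>p\<close> contributes the element \<open>b i\<close> of order \<open>p\<close>, the
  \<open>(n i div p)\<close>-th power of its generator, and all other summands have trivial socle. The coordinates of an element
  of the socle are multiples of \<open>n i div p\<close>, determined modulo \<open>n i\<close>, so the \<open>b i\<close> form a basis if they are
  finite in number; and since they are distinct, they are finite in number if the socle is finite.\<close>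

lemma finite_p_divisible_iff_Fp_basis:
  assumes p: "Factorial_Ring.prime p"
  shows "finite {i \<in> I. n i > 0 \<and> p dvd n i} \<longleftrightarrow>
    (\<exists>B. finite B \<and> Fp_basis p (G\<lparr>carrier := socle G p\<rparr>) B)"
proof -
  let ?K = "{i \<in> I. n i > 0 \<and> p dvd n i}"
  let ?V = "G\<lparr>carrier := socle G p\<rparr>"
  define m where "m i = int (n i div p)" for i
  define b where "b i = gen i [^] m i" for i
  have p0: "p > 0"
    using p prime_gt_0_nat by blast
  have nm: "int (n i) = m i * int p" "m i > 0" if i: "i \<in> ?K" for i
  proof -
    have "n i = n i div p * p"
      using i by simp
    then show "int (n i) = m i * int p"
      unfolding m_def by (metis of_nat_mult)
    then show "m i > 0"
      using i unfolding m_def by (cases "n i div p = 0") auto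
  qed
  have n_dvd_iff: "int (n i) dvd m i * k \<longleftrightarrow> int p dvd k" if i: "i \<in> ?K" for i k
    using nm[OF i] by simp
  have b_closed: "b i \<in> carrier G" if "i \<in> ?K" for i
    using that gen_closed by (simp add: b_def)
  have b_socle: "b i \<in> socle G p" if i: "i \<in> ?K" for i
  proof -
    have "b i [^] int p = \<one>"
      using i gen_closed nm[OF i] by (simp add: b_def int_pow_pow gen_pow_eq_one_iff)
    then show ?thesis
      using b_closed[OF i] by (simp add: socle_def int_pow_int)
  qed
  have inj_b: "inj_on b ?K"
  proof (rule inj_onI, rule ccontr)
    fix i j assume i: "i \<in> ?K" and j: "j \<in> ?K" and eq: "b i = b j" and "i \<noteq> j"
    have ki: "keys (frag_cmul (m i) (frag_of i)) \<subseteq> I" and kj: "keys (frag_cmul (m j) (frag_of j)) \<subseteq> I"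
      using i j keys_cmul[of "m i" "frag_of i"] keys_cmul[of "m j" "frag_of j"] by auto
    have "e (frag_cmul (m i) (frag_of i)) = e (frag_cmul (m j) (frag_of j))"
      using eq i j by (simp add: b_def e_cmul)
    then have "int (n i) dvd m i * 1"
      using e_eq_iff[OF ki kj] i \<open>i \<noteq> j\<close> by auto
    then have "int p dvd 1"
      using n_dvd_iff[OF i] by blast
    then show False
      using p by (auto simp: prime_nat_iff)
  qed
  show ?thesis
  proof
    assume "\<exists>B. finite B \<and> Fp_basis p ?V B"
    then obtain B where "finite B" "Fp_basis p ?V B"
      by blast
    then have "finite (carrier ?V)"
      by (rule finite_if_Fp_basis)
    then have "finite (b ` ?K)"
      using b_socle by (intro finite_subset[of "b ` ?K" "socle G p"]) auto
    then show "finite ?K"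
      using inj_b by (rule finite_imageD)
  next
    assume K: "finite ?K"
    \<comment> \<open>a combination of the \<open>b i\<close> has a lift to the free group whose coordinates are read off the coefficients\<close>
    define comb where "comb c = (\<Otimes>\<^bsub>?V\<^esub>x\<in>{x. c x \<noteq> 0}. x [^]\<^bsub>?V\<^esub> (c x :: nat))" for c
    have comb: "comb c = e d"
      if c: "{x. c x \<noteq> 0} \<subseteq> b ` ?K" and d: "keys d \<subseteq> ?K" "\<And>i. i \<in> ?K \<Longrightarrow> lookup d i = m i * int (c (b i))"
      for c d
    proof -
      have pow: "x [^]\<^bsub>?V\<^esub> k = x [^] k" for x and k :: nat
        by (simp add: nat_pow_def)
      have supp: "x \<in> socle G p" if "c x \<noteq> 0" for x
        using that c b_socle by blast
      have powS: "x [^] k \<in> socle G p" if "x \<in> socle G p" for x and k :: nat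
        using that subgroup_socle[of p]
        by (induction k) (simp_all add: subgroup.one_closed subgroup.m_closed)
      have "comb c = (\<Otimes>x\<in>{x. c x \<noteq> 0}. x [^] c x)"
        unfolding comb_def pow by (rule finprod_subgroup[OF subgroup_socle]) (simp add: powS supp)
      also have "\<dots> = (\<Otimes>x\<in>b ` ?K. x [^] c x)"
        using c K b_closed by (intro finprod_mono_neutral_cong_left) auto
      also have "\<dots> = (\<Otimes>i\<in>?K. b i [^] c (b i))"
        using inj_b b_closed by (subst finprod_reindex) auto
      also have "\<dots> = (\<Otimes>i\<in>?K. gen i [^] lookup d i)"
      proof (rule finprod_cong')
        show "(\<lambda>i. gen i [^] lookup d i) \<in> ?K \<rightarrow> carrier G"
          using gen_closed by auto
        fix i assume i: "i \<in> ?K"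
        then show "b i [^] c (b i) = gen i [^] lookup d i"
          using gen_closed[of i] d(2)[OF i] by (simp add: b_def int_pow_pow flip: int_pow_int)
      qed simp
      also have "\<dots> = e d"
        using e_eq_finprod[OF K _ d(1)] by auto
      finally show ?thesis .
    qed
    have "Fp_basis p ?V (b ` ?K)"
      unfolding Fp_basis_def comb_def[symmetric]
    proof (intro conjI ballI)
      show "b ` ?K \<subseteq> carrier ?V"
        using b_socle by auto
      fix x assume "x \<in> carrier ?V"
      then have x: "x \<in> socle G p" "x \<in> carrier G"
        by (auto simp: socle_def)
      obtain d where d: "keys d \<subseteq> I" "x = e d"
        using e_onto[OF x(2)] by blast
      have pd: "int (n i) dvd int p * lookup d i" if "i \<in> I" for i
        using e_in_socle_iff[OF d(1)] x(1) d(2) that by blast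
      \<comment> \<open>the coefficient of \<open>b i\<close>, reduced to its representative below \<open>p\<close>\<close>
      define q where "q i = nat (lookup d i div m i mod int p)" for i
      define c where "c y = (if y \<in> b ` ?K then q (inv_into ?K b y) else 0)" for y
      obtain d' where d': "keys d' \<subseteq> ?K" "\<And>i. lookup d' i = (if i \<in> ?K then m i * int (q i) else 0)"
        by (rule ex_poly_mapping[OF K, where f = "\<lambda>i. m i * int (q i)"]) blast
      have d'I: "keys d' \<subseteq> I"
        using d'(1) by blast
      show "\<exists>!c. (\<forall>y. c y < p) \<and> {y. c y \<noteq> 0} \<subseteq> b ` ?K \<and> finite {y. c y \<noteq> 0} \<and> x = comb c"
      proof (rule ex1I[of _ c])
        have supp: "{y. c y \<noteq> 0} \<subseteq> b ` ?K"
          by (auto simp: c_def)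
        have "int (n i) dvd lookup d i - lookup d' i" if i: "i \<in> I" for i
        proof (cases "i \<in> ?K")
          case True
          have "m i * int p dvd lookup d i * int p"
            using pd[OF i] nm[OF True] by (simp add: mult.commute)
          then obtain k where k: "lookup d i = m i * k"
            using p0 by (auto simp: dvd_def)
          then have "lookup d i div m i = k"
            using nm(2)[OF True] by simp
          then have "lookup d i - lookup d' i = m i * (k - k mod int p)"
            using True p0 by (simp add: d'(2) q_def k right_diff_distrib)
          moreover have "int p dvd k - k mod int p"
            by (simp add: minus_mod_eq_mult_div)
          ultimately show ?thesis
            using n_dvd_iff[OF True] by simp
        next
          case False
          have "int (n i) dvd lookup d i"
          proof (cases "n i = 0")
            case True
            then show ?thesis
              using pd[OF i] p0 by simp
          next
            case n: False
            then have "coprime (n i) p"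
              using False i p by (simp add: prime_imp_coprime coprime_commute)
            then have "coprime (int (n i)) (int p)"
              by simp
            then show ?thesis
              using pd[OF i] by (simp add: coprime_dvd_mult_right_iff)
          qed
          moreover have "lookup d' i = 0"
            using False d'(2)[of i] by auto
          ultimately show ?thesis
            by simp
        qed
        then have "x = e d'"
          using e_eq_iff[OF d(1) d'I] d(2) by simp
        moreover have "comb c = e d'"
          using supp d' inj_b by (intro comb) (auto simp: c_def)
        moreover have "c y < p" for y
        proof -
          have "lookup d i div m i mod int p < int p" for i
            using p0 by simp
          then show ?thesis
            using p0 unfolding c_def q_def by (simp add: nat_less_iff)
        qed
        ultimately show "(\<forall>y. c y < p) \<and> {y. c y \<noteq> 0} \<subseteq> b ` ?K \<and> finite {y. c y \<noteq> 0} \<and> x = comb c"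
          using supp finite_subset[OF supp] K by simp
        have xd': "x = e d'"
          by fact
        fix c' assume c': "(\<forall>y. c' y < p) \<and> {y. c' y \<noteq> 0} \<subseteq> b ` ?K \<and> finite {y. c' y \<noteq> 0} \<and> x = comb c'"
        obtain d'' where d'': "keys d'' \<subseteq> ?K"
          "\<And>i. lookup d'' i = (if i \<in> ?K then m i * int (c' (b i)) else 0)"
          by (rule ex_poly_mapping[OF K, where f = "\<lambda>i. m i * int (c' (b i))"]) blast
        have d''I: "keys d'' \<subseteq> I"
          using d''(1) by blast
        have "comb c' = e d''"
          using c' d'' by (intro comb) auto
        then have "e d'' = e d'"
          using c' xd' by simp
        then have dvd: "int (n i) dvd lookup d'' i - lookup d' i" if "i \<in> I" for i
          using e_eq_iff[OF d''I d'I] that by blast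
        have "c' (b i) = q i" if i: "i \<in> ?K" for i
        proof -
          have "int (n i) dvd m i * (int (c' (b i)) - int (q i))"
            using dvd[of i] i by (simp add: d'(2) d''(2) right_diff_distrib)
          then have "int (c' (b i)) mod int p = int (q i) mod int p"
            using n_dvd_iff[OF i] by (simp only: mod_eq_dvd_iff)
          moreover have "c' (b i) < p"
            using c' by blast
          moreover have "q i < p"
            using p0 by (simp add: q_def nat_less_iff)
          ultimately show ?thesis
            by simp
        qed
        then have "c' (b i) = c (b i)" if "i \<in> ?K" for i
          using that inj_b by (simp add: c_def)
        then have "c' y = c y" if "y \<in> b ` ?K" for y
          using that by blast
        moreover have "c' y = c y" if "y \<notin> b ` ?K" for y
        proof -
          have "c' y = 0"
            using that c' by blast
          then show ?thesis
            using that by (simp add: c_def)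
        qed
        ultimately show "c' = c"
          by (intro ext) blast
      qed
    qed
    then show "\<exists>B. finite B \<and> Fp_basis p ?V B"
      using K by blast
  qed
qed

end

section \<open>The equivalence\<close>

theorem proposition4p5:
  fixes G :: "('a, 'b) monoid_scheme"
    and I :: "'i set" and C :: "'i \<Rightarrow> ('c, 'd) monoid_scheme"
    and F T :: "'a set"
  assumes "comm_group G"
    and "\<And>i. i \<in> I \<Longrightarrow> group (C i) \<and> cyclic_group (C i)"
    and "G \<cong> sum_group I C"
    and "T = torsion_part G"
    and "internal_direct_sum G F T"
    and "free_abelian (G\<lparr>carrier := F\<rparr>)"
  shows "(relatively_hopfian G \<longleftrightarrow> hopfian G) \<and>
    (hopfian G \<longleftrightarrow>
       free_finite_rank (G\<lparr>carrier := F\<rparr>) \<and>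
       (\<forall>p::nat. Factorial_Ring.prime p \<longrightarrow>
          p_group_finite_rank p
            (G\<lparr>carrier := primary_part (G\<lparr>carrier := T\<rparr>) p\<rparr>)))"
proof -
  interpret G: comm_group G by fact
  obtain n e where "cyclic_presentation G I n e"
    using ex_cyclic_presentation[OF assms(1,2,3)] by blast
  then interpret cyclic_presentation G I n e .
  let ?J = "{i \<in> I. n i = 0}"
  let ?K = "\<lambda>p. {i \<in> I. n i > 0 \<and> p dvd n i}"
  let ?fin = "\<forall>p. Factorial_Ring.prime p \<longrightarrow> finite {i \<in> I. p dvd n i}"
  have "?fin \<Longrightarrow> hopfian G"
    using hopfian_if_finite by blast
  moreover have "hopfian G \<Longrightarrow> relatively_hopfian G"
    by (rule relatively_hopfian_if_hopfian[OF G.is_group])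
  moreover have "relatively_hopfian G \<Longrightarrow> ?fin"
    using finite_dvd_if_relatively_hopfian by blast
  moreover have "?fin \<longleftrightarrow> finite ?J \<and> (\<forall>p. Factorial_Ring.prime p \<longrightarrow> finite (?K p))"
    \<comment> \<open>the existence of a prime is needed to recover \<open>finite ?J\<close>\<close>
    using two_is_prime_nat unfolding finite_dvd_split_iff by blast
  moreover have "finite ?J \<longleftrightarrow> free_finite_rank (G\<lparr>carrier := F\<rparr>)"
  proof -
    have basis: "finite ?J \<longleftrightarrow> finite B" if "G\<lparr>carrier := F\<rparr> \<cong> free_Abelian_group B" for B :: "'a set"
    proof -
      obtain \<theta> where \<theta>: "\<theta> \<in> iso (G\<lparr>carrier := F\<rparr>) (free_Abelian_group B)"
        using \<open>G\<lparr>carrier := F\<rparr> \<cong> free_Abelian_group B\<close> unfolding is_iso_def by blast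
      obtain r where r: "r \<in> epi G (free_Abelian_group B)"
        and ker: "\<And>x. x \<in> carrier G \<Longrightarrow> r x = \<one>\<^bsub>free_Abelian_group B\<^esub> \<longleftrightarrow> x \<in> T"
        using internal_direct_sum_projection[OF assms(1,5) group_free_Abelian_group \<theta>] by blast
      show ?thesis
        using finite_infinite_cyclic_iff[OF r] ker unfolding assms(4) by simp
    qed
    obtain B :: "'a set" where "G\<lparr>carrier := F\<rparr> \<cong> free_Abelian_group B"
      using assms(6) unfolding free_abelian_def by blast
    then show ?thesis
      using basis unfolding free_finite_rank_def by blast
  qed
  moreover have "finite (?K p) \<longleftrightarrow>
      p_group_finite_rank p (G\<lparr>carrier := primary_part (G\<lparr>carrier := T\<rparr>) p\<rparr>)"
    if "Factorial_Ring.prime p" for p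
    unfolding p_group_finite_rank_def assms(4) socle_primary_part_torsion_part[OF that]
    by (rule finite_p_divisible_iff_Fp_basis[OF that])
  ultimately show ?thesis
    by blast
qed


end
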